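(* Let $k\ge1$, let $W_1^{\mathfrak{S}_k}$ be the algebra of symmetric polynomial differential operators in $z_1,\dots,z_k$, and let $\delta=\prod_{1\le i<j\le k}(z_i-z_j)$. For $p,q\in\mathbb{N}$ let $V_{p,q}=\sum_{j=1}^k z_j^p(\partial/\partial z_j)^q$ and let $u_{p,q}\in\mathbb{C}[z_1,\dots,z_k]^{\mathfrak{S}_k}$ be the unique polynomial with $V_{p,q}(\delta)=u_{p,q}\,\delta$. Then the left ideal of $W_1^{\mathfrak{S}_k}$ consisting of the operators which annihilate $\delta$ is generated by the elements $$V_{p,q}-u_{p,q}\qquad\text{for } p\in[0,k],\ q\in[1,k].$$
   Context: $W_1=\mathbb{C}\langle z_1,\dots,z_k,\partial/\partial z_1,\dots,\partial/\partial z_k\rangle$ is the Weyl algebra, acting naturally on $\mathbb{C}[z_1,\dots,z_k]$; $\mathfrak{S}_k$ acts on $W_1$ by permuting simultaneously the $z_j$ and the $\partial/\partial z_j$, and $W_1^{\mathfrak{S}_k}$ is the invariant subalgebra. The polynomial $u_{p,q}$ exists since $V_{p,q}(\delta)$ is antisymmetric and every antisymmetric polynomial is a symmetric polynomial times $\delta$. Intervals $[a,b]$ denote sets of integers. *)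

theory Defs
  imports Complex_Main "HOL-Library.Poly_Mapping" "HOL-Library.Cardinality"
begin

text \<open>
  Complex polynomials in the variables \<open>z\<^sub>j\<close>, \<open>j :: 'n\<close>: finitely supported maps from exponent
  vectors to coefficients. The index type stands for \<open>{1, \<dots>, k}\<close>, with \<open>k = CARD('n)\<close>.
\<close>

type_synonym 'n cpoly = "('n \<Rightarrow>\<^sub>0 nat) \<Rightarrow>\<^sub>0 complex"

definition Const :: "complex \<Rightarrow> 'n cpoly" where
  "Const c = Poly_Mapping.single 0 c"

definition Var :: "'n \<Rightarrow> 'n cpoly" where
  "Var j = Poly_Mapping.single (Poly_Mapping.single j 1) 1"

text \<open>
  In the partial derivative the truncated subtraction is harmless: if the exponent of \<open>z\<^sub>j\<close> in \<open>m\<close>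
  is \<open>0\<close>, the coefficient vanishes.
\<close>

definition pd :: "'n \<Rightarrow> 'n cpoly \<Rightarrow> 'n cpoly" where
  "pd j f = (\<Sum>m\<in>Poly_Mapping.keys f.
     Poly_Mapping.single (m - Poly_Mapping.single j 1)
       (of_nat (Poly_Mapping.lookup m j) * Poly_Mapping.lookup f m))"

text \<open>
  For a bijection \<open>\<sigma>\<close>, this is the substitution \<open>z\<^sub>j \<mapsto> z\<^bsub>\<sigma> j\<^esub>\<close> (see \<open>perm_Var\<close> and \<open>perm_mult\<close>
  below): the coefficient of \<open>perm \<sigma> f\<close> at \<open>m\<close> is the coefficient of \<open>f\<close> at \<open>m \<circ> \<sigma>\<close>.
\<close>

definition perm :: "('n \<Rightarrow> 'n) \<Rightarrow> 'n cpoly \<Rightarrow> 'n cpoly" where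
  "perm \<sigma> f = Poly_Mapping.map_key (Poly_Mapping.map_key \<sigma>) f"

definition symmetric_poly :: "'n cpoly \<Rightarrow> bool" where
  "symmetric_poly f \<longleftrightarrow> (\<forall>\<sigma>. bij \<sigma> \<longrightarrow> perm \<sigma> f = f)"

definition vandermonde :: "'n::{finite,linorder} cpoly" where
  "vandermonde = (\<Prod>(i, j)\<in>{(i, j). i < j}. Var i - Var j)"

text \<open>
  The Weyl algebra, as the algebra of operators on polynomials generated by the multiplications by
  the variables and the partial derivatives; its product is composition.
\<close>

type_synonym 'n oper = "'n cpoly \<Rightarrow> 'n cpoly"

inductive_set weyl :: "'n oper set" where
  scalar: "(\<lambda>f. Const c * f) \<in> weyl"
| var: "(\<lambda>f. Var j * f) \<in> weyl"
| pd: "pd j \<in> weyl"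
| add: "D \<in> weyl \<Longrightarrow> E \<in> weyl \<Longrightarrow> (\<lambda>f. D f + E f) \<in> weyl"
| mult: "D \<in> weyl \<Longrightarrow> E \<in> weyl \<Longrightarrow> D \<circ> E \<in> weyl"

text \<open>
  Simultaneous permutation of the \<open>z\<^sub>j\<close> and the \<open>\<partial>/\<partial>z\<^sub>j\<close> is conjugation by \<open>perm \<sigma>\<close>: conjugation is
  an algebra automorphism with the required values on the generators, see \<open>oper_perm_Var\<close> and
  \<open>oper_perm_pd\<close> below.
\<close>

definition oper_perm :: "('n \<Rightarrow> 'n) \<Rightarrow> 'n oper \<Rightarrow> 'n oper" where
  "oper_perm \<sigma> D = perm \<sigma> \<circ> D \<circ> perm (inv \<sigma>)"

definition weyl_sym :: "'n oper set" where
  "weyl_sym = {D \<in> weyl. \<forall>\<sigma>. bij \<sigma> \<longrightarrow> oper_perm \<sigma> D = D}"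

definition V :: "nat \<Rightarrow> nat \<Rightarrow> 'n::finite oper" where
  "V p q f = (\<Sum>j\<in>UNIV. Var j ^ p * (pd j ^^ q) f)"

definition u :: "nat \<Rightarrow> nat \<Rightarrow> 'n::{finite,linorder} cpoly" where
  "u p q = (THE g. symmetric_poly g \<and> V p q vandermonde = g * vandermonde)"

text \<open>
  Left ideals of an algebra \<open>A\<close> of operators containing the scalars; closure under negation follows
  from closure under multiplication by the scalar \<open>-1\<close>. The left ideal of \<open>A\<close> generated by a
  subset \<open>S\<close> is \<open>left_ideal A hull S\<close>, the intersection of all left ideals containing \<open>S\<close>.
\<close>

definition left_ideal :: "'n oper set \<Rightarrow> 'n oper set \<Rightarrow> bool" where
  "left_ideal A I \<longleftrightarrow> I \<subseteq> A \<and> (\<lambda>f. 0) \<in> I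
     \<and> (\<forall>D\<in>I. \<forall>E\<in>I. (\<lambda>f. D f + E f) \<in> I)
     \<and> (\<forall>D\<in>A. \<forall>E\<in>I. D \<circ> E \<in> I)"

lemma cpoly_induct [case_names monom plus]:
  fixes f :: "'n cpoly"
  assumes monom: "\<And>m c. P (Poly_Mapping.single m c)"
    and plus: "\<And>f g. P f \<Longrightarrow> P g \<Longrightarrow> P (f + g)"
  shows "P f"
proof (induction f rule: Poly_Mapping.update_induct)
  case const
  then show ?case using monom[of 0 0] by simp
next
  case (update f a b)
  have "Poly_Mapping.update a b f = f + Poly_Mapping.single a b"
    using update(1)
    by (intro poly_mapping_eqI) (auto simp: lookup_update lookup_add lookup_single in_keys_iff when_def)
  then show ?case using plus[OF update(3) monom] by simp
qed

lemma pd_single: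
  "pd j (Poly_Mapping.single m c) =
     Poly_Mapping.single (m - Poly_Mapping.single j 1) (of_nat (Poly_Mapping.lookup m j) * c)"
  by (cases "c = 0") (simp_all add: pd_def)

lemma pd_add: "pd j (f + g) = pd j f + pd j g"
proof -
  have *: "pd j h = (\<Sum>m\<in>A. Poly_Mapping.single (m - Poly_Mapping.single j 1)
       (of_nat (Poly_Mapping.lookup m j) * Poly_Mapping.lookup h m))"
    if "finite A" "Poly_Mapping.keys h \<subseteq> A" for A h
    unfolding pd_def using that
    by (intro sum.mono_neutral_left) (auto simp: in_keys_iff)
  let ?A = "Poly_Mapping.keys f \<union> Poly_Mapping.keys g"
  have "Poly_Mapping.keys (f + g) \<subseteq> ?A" by (rule Poly_Mapping.keys_add)
  then show ?thesis
    by (simp add: *[of ?A] lookup_add distrib_left single_add sum.distrib)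
qed

lemma pd_Var_mult: "pd i (Var j * f) = (if i = j then f else 0) + Var j * pd i f"
proof (induction f rule: cpoly_induct)
  case (monom m c)
  let ?s = "Poly_Mapping.single :: _ \<Rightarrow> nat \<Rightarrow> _"
  have 1: "?s i 1 + (m - ?s i 1) = m" if "Poly_Mapping.lookup m i \<noteq> 0"
    using that by (intro poly_mapping_eqI) (auto simp: lookup_add lookup_minus lookup_single when_def)
  have 2: "?s j 1 + m - ?s i 1 = ?s j 1 + (m - ?s i 1)" if "i \<noteq> j"
    using that by (intro poly_mapping_eqI) (auto simp: lookup_add lookup_minus lookup_single when_def)
  show ?case
  proof (cases "i = j")
    case True
    then show ?thesis using 1
      by (cases "Poly_Mapping.lookup m i = 0")
        (auto simp: Var_def mult_single pd_single lookup_add distrib_right single_add)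
  next
    case False
    then show ?thesis using 2
      by (simp add: Var_def mult_single pd_single lookup_add lookup_single)
  qed
next
  case (plus f g)
  then show ?case by (simp add: distrib_left pd_add)
qed

lemma map_key_bij_eq:
  fixes \<sigma> :: "'n \<Rightarrow> 'n"
  assumes "bij \<sigma>"
  shows "Poly_Mapping.map_key \<sigma> (Poly_Mapping.map_key (inv \<sigma>) m) = m"
    and "Poly_Mapping.map_key (inv \<sigma>) (Poly_Mapping.map_key \<sigma> m) = m"
  using assms bij_imp_bij_inv[OF assms]
  by (auto intro!: poly_mapping_eqI
      simp: map_key.rep_eq bij_is_inj bij_is_surj surj_f_inv_f inv_f_f)

lemma inj_map_key:
  fixes \<sigma> :: "'n \<Rightarrow> 'n"
  assumes "bij \<sigma>"
  shows "inj (Poly_Mapping.map_key \<sigma>)"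
  using map_key_bij_eq(2)[OF assms] by (rule inj_on_inverseI)

lemma perm_single:
  assumes "bij \<sigma>"
  shows "perm \<sigma> (Poly_Mapping.single m c) =
    Poly_Mapping.single (Poly_Mapping.map_key (inv \<sigma>) m) c"
  using map_key_single[OF inj_map_key[OF assms], of "Poly_Mapping.map_key (inv \<sigma>) m" c]
  by (simp add: perm_def map_key_bij_eq assms)

lemma perm_add:
  assumes "bij \<sigma>"
  shows "perm \<sigma> (f + g) = perm \<sigma> f + perm \<sigma> g"
  by (simp add: perm_def map_key_plus inj_map_key assms)

lemma map_key_inv_single:
  fixes \<sigma> :: "'n \<Rightarrow> 'n"
  assumes "bij \<sigma>"
  shows "Poly_Mapping.map_key (inv \<sigma>) (Poly_Mapping.single j c) = Poly_Mapping.single (\<sigma> j) c"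
  using map_key_single[of "inv \<sigma>" "\<sigma> j" c] assms
  by (simp add: bij_is_inj bij_imp_bij_inv)

lemma perm_Var:
  assumes "bij \<sigma>"
  shows "perm \<sigma> (Var j) = Var (\<sigma> j)"
  by (simp add: Var_def perm_single map_key_inv_single assms)

lemma perm_mult:
  assumes "bij \<sigma>"
  shows "perm \<sigma> (f * g) = perm \<sigma> f * perm \<sigma> g"
proof (induction f rule: cpoly_induct)
  case (monom m c)
  show ?case
  proof (induction g rule: cpoly_induct)
    case (monom m' c')
    show ?case
      using assms
      by (simp add: mult_single perm_single map_key_plus bij_is_inj bij_imp_bij_inv)
  qed (simp add: distrib_left perm_add assms)
qed (simp add: distrib_right perm_add assms)

lemma perm_perm_inv:
  assumes "bij \<sigma>"
  shows "perm \<sigma> (perm (inv \<sigma>) f) = f"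
  using assms bij_imp_bij_inv[OF assms]
  by (induction f rule: cpoly_induct)
    (simp_all add: perm_single perm_add map_key_bij_eq inv_inv_eq)

lemma oper_perm_Var:
  assumes "bij \<sigma>"
  shows "oper_perm \<sigma> (\<lambda>f. Var j * f) = (\<lambda>f. Var (\<sigma> j) * f)"
  by (rule ext) (simp add: oper_perm_def perm_mult perm_Var perm_perm_inv assms)

lemma perm_pd:
  assumes "bij \<sigma>"
  shows "perm \<sigma> (pd j f) = pd (\<sigma> j) (perm \<sigma> f)"
proof (induction f rule: cpoly_induct)
  case (monom m c)
  have inj: "inj (inv \<sigma>)" using assms by (simp add: bij_is_inj bij_imp_bij_inv)
  have "Poly_Mapping.map_key (inv \<sigma>) (m - Poly_Mapping.single j (1::nat)) =
      Poly_Mapping.map_key (inv \<sigma>) m - Poly_Mapping.map_key (inv \<sigma>) (Poly_Mapping.single j 1)"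
    by (intro poly_mapping_eqI) (simp add: map_key.rep_eq inj lookup_minus)
  moreover have "Poly_Mapping.lookup (Poly_Mapping.map_key (inv \<sigma>) m) (\<sigma> j) =
      Poly_Mapping.lookup m j"
    using assms by (simp add: map_key.rep_eq inj bij_is_inj inv_f_f)
  ultimately show ?case
    by (simp add: pd_single perm_single assms map_key_inv_single)
qed (simp add: pd_add perm_add assms)

lemma oper_perm_pd:
  assumes "bij \<sigma>"
  shows "oper_perm \<sigma> (pd j) = pd (\<sigma> j)"
  by (rule ext) (simp add: oper_perm_def perm_pd perm_perm_inv assms)

end

theory Submission
  imports Defs "HOL-Combinatorics.Transposition"
begin

text \<open>
  Every invariant operator maps \<open>\<delta>\<close> to an antisymmetric polynomial, hence to \<open>g \<delta>\<close> with \<open>g\<close>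
  symmetric. So it suffices that each \<open>D\<close> in the invariant algebra \<open>A\<close> is the sum of the
  multiplication by a symmetric polynomial \<open>g\<close> and of an element of the left ideal \<open>J\<close>: if \<open>D\<close>
  annihilates \<open>\<delta>\<close>, then \<open>g \<delta> = 0\<close> and \<open>g = 0\<close>.

  The algebra \<open>A\<close> is generated by the \<open>V p q\<close>: the symmetrizations of products of operators in one
  variable span \<open>A\<close>, and they are reduced to the \<open>V p q\<close> like polarized power sums. Let \<open>M\<close> be the
  sum of the symmetric polynomials and \<open>J\<close>. The commutator of \<open>V p q\<close> with a power sum is a
  combination of \<open>V p' q'\<close> with \<open>q' < q\<close>, so \<open>M\<close> is stable under left multiplication by \<open>V p q\<close> as
  soon as it contains \<open>V p' q'\<close> for all \<open>p'\<close> and all \<open>q' \<le> q\<close>. That \<open>M\<close> contains all \<open>V p q\<close> follows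
  by induction on \<open>q\<close>. For \<open>1 \<le> q \<le> k < p\<close> the relation \<open>\<Prod>\<^sub>i (z\<^sub>j - z\<^sub>i) = 0\<close> lowers \<open>p\<close>, with
  symmetric polynomials as coefficients on the left; for \<open>q > k\<close> the corresponding relation between
  the \<open>\<partial>\<^sub>i\<close> expresses \<open>V p q\<close> through operators \<open>V p' q'\<close> with \<open>q' < q\<close>.
\<close>

section \<open>Polynomials\<close>

lemma Const_0 [simp]: "Const 0 = 0" and Const_1 [simp]: "Const 1 = 1"
  by (simp_all add: Const_def)

lemma Const_add: "Const (a + b) = Const a + Const b"
  by (simp add: Const_def single_add)

lemma Const_mult: "Const (a * b) = Const a * Const b"
  by (simp add: Const_def mult_single)

lemma Const_uminus: "Const (- a) = - Const a"
  by (simp add: Const_def single_uminus)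

lemma Const_of_nat: "Const (of_nat n) = of_nat n"
  by (induction n) (simp_all add: Const_add)

text \<open>Induction on the total degree of a monomial, removing a variable of positive exponent.
  Product rules and homomorphism properties thus need checking against a single variable
  only.\<close>

lemma poly_induct_Var [case_names Const add Var]:
  fixes f :: "'n::finite cpoly"
  assumes Const: "\<And>c. Q (Const c)"
    and add: "\<And>f g. Q f \<Longrightarrow> Q g \<Longrightarrow> Q (f + g)"
    and Var: "\<And>j f. Q f \<Longrightarrow> Q (Var j * f)"
  shows "Q f"
proof -
  have "Q (Poly_Mapping.single m c)" for m c
  proof (induction "\<Sum>i\<in>UNIV. Poly_Mapping.lookup m i" arbitrary: m)
    case 0
    then have "m = 0" by (intro poly_mapping_eqI) simp
    then show ?case using Const[of c] by (simp add: Const_def)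
  next
    case (Suc n)
    then obtain j where j: "Poly_Mapping.lookup m j \<noteq> 0"
      by (metis sum.neutral nat.distinct(1))
    define m' where "m' = m - Poly_Mapping.single j 1"
    have m: "m = Poly_Mapping.single j 1 + m'"
      using j by (intro poly_mapping_eqI)
        (auto simp: m'_def lookup_add lookup_minus lookup_single when_def)
    have "(\<Sum>i\<in>UNIV. Poly_Mapping.lookup m i) = Suc (\<Sum>i\<in>UNIV. Poly_Mapping.lookup m' i)"
      by (simp add: m lookup_add sum.distrib lookup_single when_def)
    then have "Q (Poly_Mapping.single m' c)" using Suc by simp
    from Var[OF this, of j] show ?case
      by (simp add: Var_def mult_single m)
  qed
  then show ?thesis by (induction f rule: cpoly_induct) (auto intro: add)
qed

lemma pd_Const [simp]: "pd j (Const c) = 0"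
  by (simp add: Const_def pd_single)

lemma pd_0 [simp]: "pd j 0 = 0"
  by (simp add: pd_def)

lemma pd_Const_mult: "pd j (Const c * f) = Const c * pd j f"
  by (induction f rule: cpoly_induct)
    (simp_all add: pd_add distrib_left Const_def mult_single pd_single mult.left_commute)

lemma pd_mult:
  fixes f :: "'n::finite cpoly"
  shows "pd j (f * g) = pd j f * g + f * pd j g"
proof (induction f rule: poly_induct_Var)
  case (Var l f)
  have "pd j (Var l * f * g) = (if j = l then f * g else 0) + Var l * pd j (f * g)"
    by (simp add: mult.assoc pd_Var_mult)
  then show ?case unfolding Var pd_Var_mult by (simp add: algebra_simps)
qed (simp_all add: pd_Const_mult distrib_right pd_add)

lemma pd_Var: "pd i (Var j) = (if i = j then 1 else 0)"
  using pd_Var_mult[of i j 1] pd_Const[of i 1] by simp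

lemma pd_Var_power:
  fixes j :: "'n::finite"
  shows "pd i (Var j ^ n) = (if i = j then of_nat n * Var j ^ (n - 1) else 0)"
proof (induction n)
  case 0
  then show ?case using pd_Const[of i 1] by simp
next
  case (Suc n)
  then show ?case by (cases n) (auto simp: pd_mult pd_Var algebra_simps)
qed

lemma pd_sum: "pd j (\<Sum>x\<in>A. g x) = (\<Sum>x\<in>A. pd j (g x))"
  by (induction A rule: infinite_finite_induct) (simp_all add: pd_add)

lemma pd_commute: "pd i (pd j f) = pd j (pd i f)"
proof (induction f rule: cpoly_induct)
  case (monom m c)
  have "m - Poly_Mapping.single i 1 - Poly_Mapping.single j 1 =
    m - Poly_Mapping.single j 1 - Poly_Mapping.single i (1::nat)"
    by (intro poly_mapping_eqI) (simp add: lookup_minus)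
  then show ?case
    by (cases "i = j") (auto simp: pd_single lookup_minus lookup_single mult.left_commute)
qed (simp add: pd_add)

section \<open>The action of permutations on polynomials\<close>

lemma perm_0 [simp]: "bij \<sigma> \<Longrightarrow> perm \<sigma> 0 = 0"
  using perm_single[of \<sigma> 0 0] by simp

lemma perm_Const: "bij \<sigma> \<Longrightarrow> perm \<sigma> (Const c) = Const c"
  using map_key_plus[of "inv \<sigma>" 0 0] 
  by (simp add: Const_def perm_single bij_is_inj bij_imp_bij_inv)

lemma perm_1 [simp]: "bij \<sigma> \<Longrightarrow> perm \<sigma> 1 = 1"
  using perm_Const[of \<sigma> 1] by simp

lemma perm_uminus: "bij \<sigma> \<Longrightarrow> perm \<sigma> (- f) = - perm \<sigma> f"
  using perm_add[of \<sigma> f "- f"] by (simp add: eq_neg_iff_add_eq_0 add.commute)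

lemma perm_diff: "bij \<sigma> \<Longrightarrow> perm \<sigma> (f - g) = perm \<sigma> f - perm \<sigma> g"
  using perm_add[of \<sigma> f "- g"] by (simp add: perm_uminus)

lemma perm_sum: "bij \<sigma> \<Longrightarrow> perm \<sigma> (\<Sum>x\<in>A. g x) = (\<Sum>x\<in>A. perm \<sigma> (g x))"
  by (induction A rule: infinite_finite_induct) (simp_all add: perm_add)

lemma perm_prod: "bij \<sigma> \<Longrightarrow> perm \<sigma> (\<Prod>x\<in>A. g x) = (\<Prod>x\<in>A. perm \<sigma> (g x))"
  by (induction A rule: infinite_finite_induct) (simp_all add: perm_mult)

lemma perm_power: "bij \<sigma> \<Longrightarrow> perm \<sigma> (f ^ n) = perm \<sigma> f ^ n"
  by (induction n) (simp_all add: perm_mult)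

lemma perm_inv_perm: "bij \<sigma> \<Longrightarrow> perm (inv \<sigma>) (perm \<sigma> f) = f"
  using perm_perm_inv[of "inv \<sigma>" f] by (simp add: bij_imp_bij_inv inv_inv_eq)

lemma perm_pd_funpow: "bij \<sigma> \<Longrightarrow> perm \<sigma> ((pd j ^^ q) f) = (pd (\<sigma> j) ^^ q) (perm \<sigma> f)"
  by (induction q) (simp_all add: perm_pd)

subsection \<open>Antisymmetric polynomials\<close>

definition push :: "('n \<Rightarrow> 'n) \<Rightarrow> ('n::finite \<Rightarrow>\<^sub>0 nat) \<Rightarrow> ('n \<Rightarrow>\<^sub>0 nat)" where
  "push h m = (\<Sum>i\<in>UNIV. Poly_Mapping.single (h i) (Poly_Mapping.lookup m i))"

text \<open>The substitution \<open>z\<^sub>i \<mapsto> z\<^bsub>h i\<^esub>\<close> for a map \<open>h\<close> that need not be bijective.\<close>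

definition subst :: "('n \<Rightarrow> 'n) \<Rightarrow> 'n::finite cpoly \<Rightarrow> 'n cpoly" where
  "subst h f = (\<Sum>m\<in>Poly_Mapping.keys f. Poly_Mapping.single (push h m) (Poly_Mapping.lookup f m))"

lemma push_add: "push h (m + m') = push h m + push h m'"
  by (simp add: push_def lookup_add single_add sum.distrib)

lemma push_single: "push h (Poly_Mapping.single i n) = Poly_Mapping.single (h i) n"
proof -
  have "push h (Poly_Mapping.single i n) =
      (\<Sum>l\<in>UNIV. if i = l then Poly_Mapping.single (h i) n else 0)"
    unfolding push_def by (intro sum.cong) (auto simp: lookup_single when_def)
  then show ?thesis by simp
qed

lemma subst_single: "subst h (Poly_Mapping.single m c) = Poly_Mapping.single (push h m) c"
  by (cases "c = 0") (simp_all add: subst_def)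

lemma subst_add: "subst h (f + g) = subst h f + subst h g"
proof -
  have *: "subst h f = (\<Sum>m\<in>A. Poly_Mapping.single (push h m) (Poly_Mapping.lookup f m))"
    if "finite A" "Poly_Mapping.keys f \<subseteq> A" for A f
    unfolding subst_def using that
    by (intro sum.mono_neutral_left) (auto simp: in_keys_iff)
  let ?A = "Poly_Mapping.keys f \<union> Poly_Mapping.keys g"
  have "Poly_Mapping.keys (f + g) \<subseteq> ?A" by (rule Poly_Mapping.keys_add)
  then show ?thesis
    by (simp add: *[of ?A] lookup_add single_add sum.distrib)
qed

lemma subst_mult: "subst h (f * g) = subst h f * subst h g"
proof (induction f rule: cpoly_induct)
  case (monom m c)
  show ?case
    by (induction g rule: cpoly_induct)
      (simp_all add: mult_single subst_single push_add distrib_left subst_add)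
qed (simp add: distrib_right subst_add)

lemma subst_Const: "subst h (Const c) = Const c"
  by (simp add: Const_def subst_single push_def)

lemma subst_Var: "subst h (Var i) = Var (h i)"
  by (simp add: Var_def subst_single push_single)

lemma subst_0 [simp]: "subst h 0 = 0"
  by (simp add: subst_def)

lemma subst_diff: "subst h (f - g) = subst h f - subst h g"
  using subst_add[of h "f - g" g] by (simp add: algebra_simps)

lemma subst_uminus: "subst h (- f) = - subst h f"
  using subst_diff[of h 0 f] by simp

lemma subst_prod: "subst h (\<Prod>x\<in>A. g x) = (\<Prod>x\<in>A. subst h (g x))"
  using subst_Const[of h 1]
  by (induction A rule: infinite_finite_induct) (simp_all add: subst_mult)

lemma subst_perm:
  fixes f :: "'n::finite cpoly"
  shows "bij \<sigma> \<Longrightarrow> subst h (perm \<sigma> f) = subst (h \<circ> \<sigma>) f"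
  by (induction f rule: poly_induct_Var)
    (simp_all add: perm_Const subst_Const perm_add subst_add perm_mult perm_Var subst_mult subst_Var)

lemma Var_inject: "Var i = Var j \<longleftrightarrow> i = j"
proof
  assume "Var i = (Var j :: 'a cpoly)"
  then have "pd i (Var i) = pd i (Var j :: 'a cpoly)" by simp
  then show "i = j" by (simp add: pd_Var split: if_splits)
qed simp

text \<open>The two variables agree modulo their difference. This serves as a factor theorem: a
  polynomial that vanishes on identifying them is divisible by \<open>Var i - Var j\<close>.\<close>

lemma dvd_diff_subst:
  fixes f :: "'n::finite cpoly"
  shows "Var i - Var j dvd f - subst (id(i := j)) f"
proof (induction f rule: poly_induct_Var)
  case (Const c)
  then show ?case by (simp add: subst_Const)
next
  case (add f g)
  then have "Var i - Var j dvd (f - subst (id(i := j)) f) + (g - subst (id(i := j)) g)"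
    by (rule dvd_add)
  moreover have "f + g - subst (id(i := j)) (f + g) =
      (f - subst (id(i := j)) f) + (g - subst (id(i := j)) g)"
    unfolding subst_add by (rule add_diff_add)
  ultimately show ?case by (simp only:)
next
  case (Var l f)
  let ?s = "subst (id(i := j))"
  have "Var l * f - ?s (Var l * f) =
      Var l * (f - ?s f) + (if l = i then (Var i - Var j) * ?s f else 0)"
    by (simp add: subst_mult subst_Var algebra_simps)
  moreover have "Var i - Var j dvd Var l * (f - ?s f)" using Var by (rule dvd_mult)
  ultimately show ?case by (auto simp only: intro: dvd_add dvd_triv_left split: if_splits)
qed

text \<open>Factors are split off one at a time: the substitution kills \<open>f\<close> but not the
  factors already removed, so in an integral domain it kills the cofactor.\<close>

lemma prod_dvd_if_subst_eq_0:
  fixes f :: "'n::{finite,linorder} cpoly"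
  assumes "B \<subseteq> {(i, j). i < j}"
    and "\<And>i j. (i, j) \<in> B \<Longrightarrow> subst (id(i := j)) f = 0"
  shows "(\<Prod>(i, j)\<in>B. Var i - Var j) dvd f"
proof -
  have "finite B" by simp
  then show ?thesis using assms
  proof (induction B rule: finite_induct)
    case (insert x B)
    obtain i j where x: "x = (i, j)" by (cases x)
    let ?s = "subst (id(i := j))"
    from insert obtain g where g: "f = (\<Prod>(i, j)\<in>B. Var i - Var j) * g"
      by (auto simp: dvd_def)
    have "?s (\<Prod>(i, j)\<in>B. Var i - Var j) = (\<Prod>y\<in>B. ?s (Var (fst y) - Var (snd y)))"
      by (simp add: subst_prod case_prod_beta)
    \<comment> \<open>The pairs \<open>y\<close> and \<open>(i, j)\<close> are distinct and both
      increasing, so identifying \<open>i\<close> with \<open>j\<close> does not make the entries of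
      \<open>y\<close> equal.\<close>
    moreover have "?s (Var (fst y) - Var (snd y)) \<noteq> 0" if "y \<in> B" for y
      using that insert.hyps insert.prems(1) x
      by (cases y) (auto simp: subst_diff subst_Var Var_inject)
    ultimately have "?s (\<Prod>(i, j)\<in>B. Var i - Var j) \<noteq> 0" by simp
    moreover have "?s f = 0" by (rule insert.prems(2)) (simp add: x)
    ultimately have "?s g = 0" by (simp add: g subst_mult)
    with dvd_diff_subst[of i j g] have "Var i - Var j dvd g" by simp
    then have "(\<Prod>(i, j)\<in>B. Var i - Var j) * (Var i - Var j) dvd f"
      unfolding g by (rule mult_dvd_mono[OF dvd_refl])
    then show ?case using insert.hyps x by (simp add: mult.commute)
  qed simp
qed

lemma vandermonde_nonzero: "vandermonde \<noteq> (0 :: 'n::{finite,linorder} cpoly)"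
proof -
  have "Var (fst x) - Var (snd x) \<noteq> (0 :: 'n cpoly)" if "x \<in> {(i, j). i < j}" for x
    using that by (cases x) (auto simp: Var_inject)
  then show ?thesis by (auto simp: vandermonde_def case_prod_beta)
qed

lemma perm_vandermonde:
  fixes \<sigma> :: "'n::{finite,linorder} \<Rightarrow> 'n"
  assumes "bij \<sigma>"
  shows "perm \<sigma> vandermonde = vandermonde \<or> perm \<sigma> vandermonde = - vandermonde"
proof -
  let ?B = "{(i, j). i < j} :: ('n \<times> 'n) set"
  \<comment> \<open>\<open>\<phi>\<close> puts the image of a pair back into increasing order, and
    \<open>s\<close> records the sign this costs.\<close>
  define \<phi> where "\<phi> = (\<lambda>(i, j). if \<sigma> i < \<sigma> j then (\<sigma> i, \<sigma> j) else (\<sigma> j, \<sigma> i))"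
  define s :: "'n \<times> 'n \<Rightarrow> 'n cpoly" where "s = (\<lambda>(i, j). if \<sigma> i < \<sigma> j then 1 else -1)"
  have inj: "\<sigma> a = \<sigma> b \<longleftrightarrow> a = b" for a b
    using assms by (auto dest: bij_is_inj injD)
  have "inj_on \<phi> ?B"
    by (auto simp: inj_on_def \<phi>_def inj split: if_splits)
  moreover have "\<phi> ` ?B \<subseteq> ?B"
    by (auto simp: \<phi>_def inj split: if_splits) (metis inj linorder_neqE order_less_irrefl)
  ultimately have bij: "bij_betw \<phi> ?B ?B"
    by (simp add: bij_betw_def endo_inj_surj)
  have "perm \<sigma> vandermonde = (\<Prod>x\<in>?B. Var (\<sigma> (fst x)) - Var (\<sigma> (snd x)))"
    unfolding vandermonde_def by (simp add: perm_prod assms case_prod_beta perm_diff perm_Var)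
  also have "\<dots> = (\<Prod>x\<in>?B. s x * (Var (fst (\<phi> x)) - Var (snd (\<phi> x))))"
    by (intro prod.cong) (auto simp: s_def \<phi>_def)
  also have "\<dots> = prod s ?B * vandermonde"
    unfolding prod.distrib vandermonde_def
    using prod.reindex_bij_betw[OF bij, of "\<lambda>x. Var (fst x) - Var (snd x) :: 'n cpoly"]
    by (simp add: case_prod_beta)
  finally have *: "perm \<sigma> vandermonde = prod s ?B * vandermonde" .
  have "prod s A = 1 \<or> prod s A = -1" for A
  proof (induction A rule: infinite_finite_induct)
    case (insert x A)
    have "s x = 1 \<or> s x = -1" by (simp add: s_def case_prod_beta)
    with insert show ?case by auto
  qed simp_all
  then show ?thesis using * by (metis mult_1 mult_minus1)
qed

text \<open>Identifying the two variables absorbs the transposition, so the substituted polynomial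
  equals its own negative, and 2 is not a zero divisor.\<close>

lemma subst_eq_0_if_antisymmetric:
  fixes f :: "'n::{finite,linorder} cpoly"
  assumes "perm (transpose i j) f = - f"
  shows "subst (id(i := j)) f = 0"
proof -
  have "id(i := j) \<circ> transpose i j = id(i := j)"
    by (auto simp: fun_eq_iff transpose_def)
  then have "subst (id(i := j)) f = - subst (id(i := j)) f"
    using subst_perm[of "transpose i j" "id(i := j)" f] assms
    by (simp add: subst_uminus)
  then have "2 * subst (id(i := j)) f = 0" by simp
  moreover have "(2 :: 'n cpoly) \<noteq> 0"
  proof
    assume "(2 :: 'n cpoly) = 0"
    then have "Const (1 + 1) = (0 :: 'n cpoly)"
      unfolding Const_add by simp
    then have "Poly_Mapping.lookup (Const (1 + 1) :: 'n cpoly) 0 = 0"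
      by (simp only: lookup_zero)
    then show False unfolding Const_def lookup_single_eq by simp
  qed
  ultimately show ?thesis by simp
qed

text \<open>The sign is \<open>-1\<close> because otherwise \<open>\<delta> / (z\<^sub>i - z\<^sub>j)\<close> would be antisymmetric under the
  transposition, hence divisible by \<open>z\<^sub>i - z\<^sub>j\<close>.\<close>

lemma perm_transpose_vandermonde:
  fixes i j :: "'n::{finite,linorder}"
  assumes "i < j"
  shows "perm (transpose i j) vandermonde = - vandermonde"
proof (rule ccontr)
  assume "\<not> ?thesis"
  then have \<tau>: "perm (transpose i j) vandermonde = vandermonde"
    using perm_vandermonde[of "transpose i j"] by simp
  let ?B = "{(a, b). a < b} - {(i, j)} :: ('n \<times> 'n) set"
  define R where "R = (\<Prod>(a, b)\<in>?B. Var a - Var b :: 'n cpoly)"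
  have v: "vandermonde = (Var i - Var j) * R"
    unfolding vandermonde_def R_def using assms
    by (subst prod.remove[of _ "(i, j)"]) auto
  have "perm (transpose i j) vandermonde = (Var j - Var i) * perm (transpose i j) R"
    unfolding v by (simp add: perm_mult perm_diff perm_Var)
  with \<tau> v have "(Var i - Var j) * R = (Var j - Var i) * perm (transpose i j) R" by simp
  then have "(Var i - Var j) * R = (Var i - Var j) * (- perm (transpose i j) R)"
    by (simp add: algebra_simps)
  moreover have "Var i - Var j \<noteq> (0 :: 'n cpoly)" using assms by (simp add: Var_inject)
  ultimately have "R = - perm (transpose i j) R" by (simp only: mult_cancel_left) simp
  then have "perm (transpose i j) R = - R" by (metis minus_minus)
  then have "subst (id(i := j)) R = 0" by (rule subst_eq_0_if_antisymmetric)
  moreover have "subst (id(i := j)) (Var (fst y) - Var (snd y) :: 'n cpoly) \<noteq> 0" if "y \<in> ?B" for y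
    using that assms by (cases y) (auto simp: subst_diff subst_Var Var_inject)
  then have "subst (id(i := j)) R \<noteq> 0"
    by (auto simp: R_def subst_prod case_prod_beta)
  ultimately show False by simp
qed

section \<open>Invariant differential operators\<close>

lemma weyl_add: "D \<in> weyl \<Longrightarrow> D (f + g) = D f + D g"
  by (induction arbitrary: f g rule: weyl.induct) (simp_all add: distrib_left pd_add algebra_simps)

lemma weyl_Const_mult: "D \<in> weyl \<Longrightarrow> D (Const c * f) = Const c * D f"
  by (induction arbitrary: f rule: weyl.induct)
    (simp_all add: pd_Const_mult mult.left_commute distrib_left)

lemma weyl_uminus: "D \<in> weyl \<Longrightarrow> D (- f) = - D f"
  using weyl_Const_mult[of D "-1" f] by (simp add: Const_uminus)

lemma weyl_0: "D \<in> weyl \<Longrightarrow> D 0 = 0"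
  using weyl_Const_mult[of D 0 0] by simp

lemma weyl_id: "(\<lambda>f. f) \<in> weyl"
  using weyl.scalar[of 1] by (simp add: lambda_one)

lemma weyl_mult_poly:
  fixes g :: "'n::finite cpoly"
  shows "(\<lambda>f. g * f) \<in> weyl"
proof (induction g rule: poly_induct_Var)
  case (Const c)
  show ?case by (rule weyl.scalar)
next
  case (add g h)
  then show ?case using weyl.add[OF add] by (simp add: distrib_right)
next
  case (Var j g)
  then show ?case using weyl.mult[OF weyl.var[of j] Var] by (simp add: o_def mult.assoc)
qed

lemma weyl_pd_funpow: "(pd j ^^ q) \<in> weyl"
proof (induction q)
  case 0
  show ?case using weyl_id by (simp add: id_def)
next
  case (Suc q)
  then show ?case using weyl.mult[OF weyl.pd[of j] Suc] by (simp only: funpow.simps)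
qed

lemma weyl_sum: "finite A \<Longrightarrow> (\<And>x. x \<in> A \<Longrightarrow> D x \<in> weyl) \<Longrightarrow> (\<lambda>f. \<Sum>x\<in>A. D x f) \<in> weyl"
proof (induction A rule: finite_induct)
  case empty
  show ?case using weyl.scalar[of 0] by (simp add: lambda_zero)
next
  case (insert x A)
  then show ?case using weyl.add[of "D x" "\<lambda>f. \<Sum>x\<in>A. D x f"] by simp
qed

lemma weyl_V: "(V p q :: 'n::finite oper) \<in> weyl"
proof -
  have "(\<lambda>f. Var j ^ p * (pd j ^^ q) f) \<in> weyl" for j :: 'n
    using weyl.mult[OF weyl_mult_poly weyl_pd_funpow] by (simp add: o_def)
  then have "(\<lambda>f :: 'n cpoly. V p q f) \<in> weyl" unfolding V_def by (intro weyl_sum) auto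
  then show ?thesis by simp
qed

text \<open>Invariance under conjugation becomes equivariance, the form in which it is used from
  here on.\<close>

lemma weyl_sym_iff:
  "D \<in> weyl_sym \<longleftrightarrow> D \<in> weyl \<and> (\<forall>\<sigma>. bij \<sigma> \<longrightarrow> (\<forall>f. perm \<sigma> (D f) = D (perm \<sigma> f)))"
proof -
  have "oper_perm \<sigma> D = D \<longleftrightarrow> (\<forall>f. perm \<sigma> (D f) = D (perm \<sigma> f))" if "bij \<sigma>" for \<sigma>
    using that unfolding oper_perm_def fun_eq_iff o_def
    by (metis perm_perm_inv perm_inv_perm)
  then show ?thesis by (auto simp: weyl_sym_def)
qed

lemma weyl_sym_weyl: "D \<in> weyl_sym \<Longrightarrow> D \<in> weyl"
  by (simp add: weyl_sym_def)

lemma weyl_sym_comp: "D \<in> weyl_sym \<Longrightarrow> E \<in> weyl_sym \<Longrightarrow> D \<circ> E \<in> weyl_sym"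
  by (auto simp: weyl_sym_iff intro: weyl.mult)

lemma weyl_sym_add: "D \<in> weyl_sym \<Longrightarrow> E \<in> weyl_sym \<Longrightarrow> (\<lambda>f. D f + E f) \<in> weyl_sym"
  by (auto simp: weyl_sym_iff perm_add intro: weyl.add)

lemma weyl_sym_mult_poly:
  fixes g :: "'n::finite cpoly"
  shows "symmetric_poly g \<Longrightarrow> (\<lambda>f. g * f) \<in> weyl_sym"
  by (auto simp: weyl_sym_iff symmetric_poly_def perm_mult weyl_mult_poly)

lemma weyl_sym_V: "V p q \<in> weyl_sym"
  unfolding weyl_sym_iff
proof (intro conjI allI impI weyl_V)
  fix \<sigma> :: "'a \<Rightarrow> 'a" and f assume \<sigma>: "bij \<sigma>"
  have "perm \<sigma> (V p q f) = (\<Sum>j\<in>UNIV. Var (\<sigma> j) ^ p * (pd (\<sigma> j) ^^ q) (perm \<sigma> f))"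
    by (simp add: V_def perm_sum perm_mult perm_power perm_Var perm_pd_funpow \<sigma>)
  also have "\<dots> = V p q (perm \<sigma> f)"
    unfolding V_def by (rule sum.reindex_bij_betw[OF \<sigma>])
  finally show "perm \<sigma> (V p q f) = V p q (perm \<sigma> f)" .
qed

section \<open>Quotients by the Vandermonde polynomial\<close>

lemma symmetric_poly_Const: "symmetric_poly (Const c)"
  by (simp add: symmetric_poly_def perm_Const)

lemma symmetric_poly_add: "symmetric_poly f \<Longrightarrow> symmetric_poly g \<Longrightarrow> symmetric_poly (f + g)"
  by (simp add: symmetric_poly_def perm_add)

lemma symmetric_poly_mult: "symmetric_poly f \<Longrightarrow> symmetric_poly g \<Longrightarrow> symmetric_poly (f * g)"
  by (simp add: symmetric_poly_def perm_mult)

text \<open>By equivariance the image is still antisymmetric under transpositions, hence divisible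
  by every factor. A permutation changes image and \<open>vandermonde\<close> by the same sign, so
  it fixes the quotient.\<close>

lemma vandermonde_quotient:
  fixes D :: "'n::{finite,linorder} oper"
  assumes D: "D \<in> weyl_sym"
  shows "\<exists>g. symmetric_poly g \<and> D vandermonde = g * vandermonde"
proof -
  have perm_D: "perm \<sigma> (D f) = D (perm \<sigma> f)" if "bij \<sigma>" for \<sigma> f
    using D that by (simp add: weyl_sym_iff)
  have neg: "D (- f) = - D f" for f
    by (rule weyl_uminus[OF weyl_sym_weyl[OF D]])
  have "vandermonde dvd D vandermonde"
    unfolding vandermonde_def[where 'n = 'n]
  proof (rule prod_dvd_if_subst_eq_0)
    fix i j :: 'n assume "(i, j) \<in> {(i, j). i < j}"
    then have "perm (transpose i j) (D vandermonde) = - D vandermonde"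
      by (simp add: perm_D perm_transpose_vandermonde neg)
    then show "subst (id(i := j)) (D (\<Prod>(i, j)\<in>{(i, j). i < j}. Var i - Var j)) = 0"
      unfolding vandermonde_def[symmetric] by (rule subst_eq_0_if_antisymmetric)
  qed simp
  then obtain g where g: "D vandermonde = g * vandermonde" by (auto simp: dvd_def mult.commute)
  have "perm \<sigma> g = g" if \<sigma>: "bij \<sigma>" for \<sigma>
  proof -
    have "perm \<sigma> g * perm \<sigma> vandermonde = D (perm \<sigma> vandermonde)"
      using \<sigma> by (simp flip: perm_D perm_mult add: g)
    also have "\<dots> = g * perm \<sigma> vandermonde"
      using perm_vandermonde[OF \<sigma>] by (auto simp: g neg)
    finally show ?thesis
      using perm_vandermonde[OF \<sigma>] vandermonde_nonzero[where 'n = 'n] by auto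
  qed
  with g show ?thesis by (auto simp: symmetric_poly_def)
qed

text \<open>The description in \<open>u\<close> is proper: existence is
  \<open>vandermonde_quotient\<close>, uniqueness is cancellation of
  \<open>vandermonde\<close>.\<close>

lemma
  shows symmetric_poly_u: "symmetric_poly (u p q :: 'n::{finite,linorder} cpoly)"
    and V_vandermonde: "V p q vandermonde = u p q * (vandermonde :: 'n cpoly)"
proof -
  have "\<exists>!g :: 'n cpoly. symmetric_poly g \<and> V p q vandermonde = g * vandermonde"
    using vandermonde_quotient[OF weyl_sym_V, of p q] vandermonde_nonzero[where 'n = 'n] by auto
  from theI'[OF this]
  show "symmetric_poly (u p q :: 'n cpoly)" "V p q vandermonde = u p q * (vandermonde :: 'n cpoly)"
    by (auto simp: u_def)
qed

subsection \<open>Symmetrized products of operators in one variable\<close>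

text \<open>
  An element of the Weyl algebra in one variable is represented by the family of its copies in the
  variables \<open>z\<^sub>j\<close>; \<open>fam d\<close> consists of the elements of order at most \<open>d\<close>.
\<close>

inductive_set fam :: "nat \<Rightarrow> ('n \<Rightarrow> 'n oper) set" for d where
  monom: "q \<le> d \<Longrightarrow> (\<lambda>j f. Const c * (Var j ^ p * (pd j ^^ q) f)) \<in> fam d"
| add: "v \<in> fam d \<Longrightarrow> w \<in> fam d \<Longrightarrow> (\<lambda>j f. v j f + w j f) \<in> fam d"

lemma fam_mono: "w \<in> fam d \<Longrightarrow> d \<le> e \<Longrightarrow> w \<in> fam e"
  by (induction rule: fam.induct) (auto intro: fam.intros)

lemma fam_monom: "q \<le> d \<Longrightarrow> (\<lambda>j f. Var j ^ p * (pd j ^^ q) f) \<in> fam d"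
  using fam.monom[of q d 1 p] by simp

lemma fam_id: "(\<lambda>j f. f) \<in> fam d"
  using fam_monom[of 0 d 0] by simp

lemma fam_pd: "1 \<le> d \<Longrightarrow> pd \<in> fam d"
  using fam_monom[of 1 d 0] by simp

lemma fam_Const_mult: "w \<in> fam d \<Longrightarrow> (\<lambda>j f. Const c * w j f) \<in> fam d"
proof (induction rule: fam.induct)
  case (monom q b p)
  then show ?case using fam.monom[of q d "c * b" p] by (simp add: Const_mult mult.assoc)
next
  case (add v w)
  then show ?case using fam.add[OF add.IH] by (simp add: distrib_left)
qed

lemma fam_Var_mult: "w \<in> fam d \<Longrightarrow> (\<lambda>j f. Var j * w j f) \<in> fam d"
proof (induction rule: fam.induct)
  case (monom q b p)
  then show ?case using fam.monom[of q d b "Suc p"]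
    by (simp add: mult.assoc mult.left_commute)
next
  case (add v w)
  then show ?case using fam.add[OF add.IH] by (simp add: distrib_left)
qed

lemma fam_Var_power_mult: "w \<in> fam d \<Longrightarrow> (\<lambda>j f. Var j ^ p * w j f) \<in> fam d"
proof (induction p)
  case (Suc p)
  from fam_Var_mult[OF Suc.IH[OF Suc.prems]] show ?case by (simp add: mult.assoc)
qed simp

lemma fam_pd_comp:
  fixes w :: "'n::finite \<Rightarrow> 'n oper"
  shows "w \<in> fam d \<Longrightarrow> (\<lambda>j f. pd j (w j f)) \<in> fam (Suc d)"
proof (induction rule: fam.induct)
  case (monom q b p)
  \<comment> \<open>The product rule restores normal order. For \<open>p = 0\<close> the truncated
    exponent \<open>p - 1\<close> comes with coefficient 0.\<close>
  have "(\<lambda>j f. Const (b * of_nat p) * (Var j ^ (p - 1) * (pd j ^^ q) f)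
      + Const b * (Var j ^ p * (pd j ^^ Suc q) f)) \<in> fam (Suc d)"
    using monom by (intro fam.intros) auto
  moreover have "(\<lambda>(j :: 'n) f. pd j (Const b * (Var j ^ p * (pd j ^^ q) f))) =
     (\<lambda>j f. Const (b * of_nat p) * (Var j ^ (p - 1) * (pd j ^^ q) f)
      + Const b * (Var j ^ p * (pd j ^^ Suc q) f))"
    by (simp add: fun_eq_iff pd_Const_mult pd_mult pd_Var_power Const_mult Const_of_nat algebra_simps)
  ultimately show ?case by simp
next
  case (add v w)
  then show ?case using fam.add[OF add.IH] by (simp add: pd_add)
qed

lemma fam_pd_funpow_comp:
  fixes w :: "'n::finite \<Rightarrow> 'n oper"
  shows "w \<in> fam d \<Longrightarrow> (\<lambda>j f. (pd j ^^ q) (w j f)) \<in> fam (q + d)"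
proof (induction q)
  case (Suc q)
  from fam_pd_comp[OF Suc.IH[OF Suc.prems]] show ?case by simp
qed simp

lemma fam_comp:
  fixes v w :: "'n::finite \<Rightarrow> 'n oper"
  assumes "v \<in> fam d" "w \<in> fam e"
  shows "(\<lambda>j f. v j (w j f)) \<in> fam (d + e)"
  using assms(1)
proof (induction rule: fam.induct)
  case (monom q c p)
  have "(\<lambda>j f. Const c * (Var j ^ p * (pd j ^^ q) (w j f))) \<in> fam (q + e)"
    by (intro fam_Const_mult fam_Var_power_mult fam_pd_funpow_comp assms)
  then show ?case by (rule fam_mono) (use monom in simp)
next
  case (add v v')
  then show ?case using fam.add[OF add.IH] by simp
qed

lemma pd_funpow_add: "(pd j ^^ q) (f + g) = (pd j ^^ q) f + (pd j ^^ q) g"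
  by (rule weyl_add[OF weyl_pd_funpow])

lemma pd_Var_power_commute:
  fixes i j :: "'n::finite"
  shows "i \<noteq> j \<Longrightarrow> (pd i ^^ q) (Var j ^ p * f) = Var j ^ p * (pd i ^^ q) f"
  by (induction q) (simp_all add: pd_mult pd_Var_power)

lemma pd_funpow_commute: "(pd i ^^ q) ((pd j ^^ r) f) = (pd j ^^ r) ((pd i ^^ q) f)"
proof -
  have *: "pd i ((pd j ^^ r) f) = (pd j ^^ r) (pd i f)" for f
    by (induction r) (simp_all add: pd_commute[of i j])
  show ?thesis by (induction q) (simp_all add: *)
qed

lemma fam_weyl:
  fixes w :: "'n::finite \<Rightarrow> 'n oper"
  shows "w \<in> fam d \<Longrightarrow> w j \<in> weyl"
proof (induction rule: fam.induct)
  case (monom q c p)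
  show ?case
    using weyl.mult[OF weyl_mult_poly weyl_pd_funpow, of "Const c * Var j ^ p" q j]
    by (simp add: o_def mult.assoc)
qed (rule weyl.add)

lemma fam_commute:
  fixes v w :: "'n::finite \<Rightarrow> 'n oper"
  assumes v: "v \<in> fam d" and w: "w \<in> fam e" and "i \<noteq> j"
  shows "v i (w j f) = w j (v i f)"
  using v
proof (induction rule: fam.induct)
  case (monom q c p)
  have "Var i ^ p * (pd i ^^ q) (w j f) = w j (Var i ^ p * (pd i ^^ q) f)"
    using w
  proof (induction rule: fam.induct)
    case (monom q' c' p')
    have "(pd i ^^ q) (Const c' * (Var j ^ p' * (pd j ^^ q') f)) =
        Const c' * (Var j ^ p' * (pd j ^^ q') ((pd i ^^ q) f))"
      using \<open>i \<noteq> j\<close>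
      by (simp add: weyl_Const_mult[OF weyl_pd_funpow] pd_Var_power_commute pd_funpow_commute)
    then show ?case
      using \<open>i \<noteq> j\<close> by (simp add: pd_Var_power_commute mult.left_commute)
  qed (simp add: pd_funpow_add distrib_left)
  then show ?case by (simp add: weyl_Const_mult[OF fam_weyl[OF w]])
next
  case (add v v')
  then show ?case by (simp add: weyl_add[OF fam_weyl[OF w]])
qed

text \<open>This equivariance is the reason for working with whole families: a permutation merely
  moves an operator to its copy in another variable.\<close>

lemma perm_fam:
  fixes w :: "'n::finite \<Rightarrow> 'n oper"
  assumes "w \<in> fam d" "bij \<sigma>"
  shows "perm \<sigma> (w j f) = w (\<sigma> j) (perm \<sigma> f)"
  using assms(1)
  by (induction rule: fam.induct)
    (simp_all add: assms(2) perm_mult perm_Const perm_power perm_Var perm_pd_funpow perm_add)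

text \<open>Each \<open>a j\<close> is a whole family of which only the copy in variable
  \<open>j\<close> is used; composing \<open>a\<close> with a permutation redistributes the factors.
  For \<open>fams a\<close> the fold is independent of the order by
  \<open>fam_commute\<close>.\<close>

definition fam_prod :: "('n \<Rightarrow> 'n \<Rightarrow> 'n oper) \<Rightarrow> 'n set \<Rightarrow> 'n oper" where
  "fam_prod a A = Finite_Set.fold (\<lambda>j D. a j j \<circ> D) (\<lambda>f. f) A"

abbreviation fams :: "('n \<Rightarrow> 'n \<Rightarrow> 'n oper) \<Rightarrow> bool" where
  "fams a \<equiv> \<forall>j. \<exists>d. a j \<in> fam d"

lemma fams_comp:
  assumes "fams a"
  shows "fams (a \<circ> \<sigma>)"
  using assms by simp

lemma fams_upd:
  assumes "fams a" "w \<in> fam d"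
  shows "fams (a(i := w))"
  using assms by auto

lemma fams_upd_comp:
  fixes a :: "'n::finite \<Rightarrow> 'n \<Rightarrow> 'n oper"
  assumes "fams a" "w \<in> fam d"
  shows "fams (a(i := \<lambda>j f. w j (a i j f)))"
proof -
  obtain e where "a i \<in> fam e" using assms(1) by blast
  from fam_comp[OF assms(2) this] assms(1) show ?thesis by (intro fams_upd)
qed

lemma comp_fun_commute_fams:
  fixes a :: "'n::finite \<Rightarrow> 'n \<Rightarrow> 'n oper"
  assumes "fams a"
  shows "comp_fun_commute (\<lambda>j D. a j j \<circ> D)"
proof
  fix i j
  obtain d e where "a i \<in> fam d" "a j \<in> fam e" using assms by blast
  then have "a i i (a j j f) = a j j (a i i f)" for f
    using fam_commute[of "a i" d "a j" e i j f] by (cases "i = j") auto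
  then show "(\<lambda>D. a j j \<circ> D) \<circ> (\<lambda>D. a i i \<circ> D) = (\<lambda>D. a i i \<circ> D) \<circ> (\<lambda>D. a j j \<circ> D)"
    by (auto simp: fun_eq_iff)
qed

lemma fam_prod_empty: "fam_prod a {} = (\<lambda>f. f)"
  by (simp add: fam_prod_def)

lemma fam_prod_insert:
  fixes a :: "'n::finite \<Rightarrow> 'n \<Rightarrow> 'n oper"
  assumes "fams a" "j \<notin> A"
  shows "fam_prod a (insert j A) = a j j \<circ> fam_prod a A"
proof -
  interpret comp_fun_commute "\<lambda>j D. a j j \<circ> D" by (rule comp_fun_commute_fams[OF assms(1)])
  show ?thesis unfolding fam_prod_def using assms(2) by simp
qed

lemma fam_prod_cong:
  fixes a b :: "'n::finite \<Rightarrow> 'n \<Rightarrow> 'n oper"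
  assumes "fams a" "fams b" "\<And>j. j \<in> A \<Longrightarrow> a j = b j"
  shows "fam_prod a A = fam_prod b A"
proof -
  have "finite A" by simp
  then show ?thesis using assms(3)
    by (induction A rule: finite_induct) (simp_all add: fam_prod_empty fam_prod_insert assms)
qed

text \<open>Since the factors commute, the one at \<open>j\<close> can be placed outermost, where it
  merges with \<open>w j\<close>.\<close>

lemma fam_comp_fam_prod:
  fixes a :: "'n::finite \<Rightarrow> 'n \<Rightarrow> 'n oper"
  assumes "fams a" "w \<in> fam d"
  shows "w j (fam_prod a UNIV f) = fam_prod (a(j := \<lambda>i f. w i (a j i f))) UNIV f"
proof -
  let ?b = "a(j := \<lambda>i f. w i (a j i f))"
  have b: "fams ?b" by (rule fams_upd_comp[OF assms])
  have "fam_prod ?b (UNIV - {j}) = fam_prod a (UNIV - {j})"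
    by (rule fam_prod_cong[OF b assms(1)]) simp
  then have "fam_prod ?b (insert j (UNIV - {j})) f = w j (a j j (fam_prod a (UNIV - {j}) f))"
    by (subst fam_prod_insert[OF b]) simp_all
  moreover have "fam_prod a (insert j (UNIV - {j})) f = a j j (fam_prod a (UNIV - {j}) f)"
    by (subst fam_prod_insert[OF assms(1)]) simp_all
  ultimately show ?thesis by (simp add: insert_absorb)
qed

lemma perm_fam_prod:
  fixes a :: "'n::finite \<Rightarrow> 'n \<Rightarrow> 'n oper"
  assumes "fams a" "bij \<sigma>"
  shows "perm \<sigma> (fam_prod a UNIV f) = fam_prod (a \<circ> inv \<sigma>) UNIV (perm \<sigma> f)"
proof -
  have "perm \<sigma> (fam_prod a A f) = fam_prod (a \<circ> inv \<sigma>) (\<sigma> ` A) (perm \<sigma> f)" for A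
  proof -
    have "finite A" by simp
    then show ?thesis
    proof (induction A rule: finite_induct)
      case (insert j A)
      obtain d where d: "a j \<in> fam d" using assms(1) by blast
      have "\<sigma> j \<notin> \<sigma> ` A" using insert.hyps assms(2) by (auto dest: bij_is_inj injD)
      moreover have "inv \<sigma> (\<sigma> j) = j" using assms(2) by (simp add: bij_is_inj)
      ultimately show ?case
        using insert fam_prod_insert[OF fams_comp[OF assms(1)], of "\<sigma> j" "\<sigma> ` A" "inv \<sigma>"]
        by (simp add: fam_prod_insert[OF assms(1)] perm_fam[OF d assms(2)])
    qed (simp add: fam_prod_empty)
  qed
  from this[of UNIV] show ?thesis using assms(2) by (simp add: bij_is_surj)
qed

lemma fam_prod_trivial:
  fixes A :: "'n::finite set"
  shows "fam_prod (\<lambda>i j f. f) A = (\<lambda>f. f)"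
proof -
  have I: "fams (\<lambda>(i :: 'n) j f. f)" using fam_id by blast
  have "finite A" by simp
  then show ?thesis
    by (induction A rule: finite_induct) (auto simp: fam_prod_empty fam_prod_insert[OF I])
qed

text \<open>The symmetrization of a product, unnormalized: the trivial family yields the number of
  permutations, which is divided out only at the end.\<close>

definition orb :: "('n::finite \<Rightarrow> 'n \<Rightarrow> 'n oper) \<Rightarrow> 'n oper" where
  "orb a f = (\<Sum>\<sigma> | bij \<sigma>. fam_prod (a \<circ> \<sigma>) UNIV f)"

lemma orb_trivial: "orb (\<lambda>i j f. f) f = of_nat (card {\<sigma> :: 'n::finite \<Rightarrow> 'n. bij \<sigma>}) * (f :: 'n cpoly)"
  by (simp add: orb_def o_def fam_prod_trivial)

lemma card_bij_nonzero: "card {\<sigma> :: 'n::finite \<Rightarrow> 'n. bij \<sigma>} \<noteq> 0"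
  using bij_id by (auto simp: card_eq_0_iff)

lemma orb_relabel:
  fixes a :: "'n::finite \<Rightarrow> 'n \<Rightarrow> 'n oper"
  assumes "bij \<tau>"
  shows "orb (a \<circ> \<tau>) = orb a"
proof
  fix f
  have "bij_betw (\<lambda>\<sigma>. \<tau> \<circ> \<sigma>) {\<sigma>. bij \<sigma>} {\<sigma>. bij \<sigma>}"
    using assms bij_imp_bij_inv[OF assms]
    by (intro bij_betw_byWitness[where f' = "\<lambda>\<sigma>. inv \<tau> \<circ> \<sigma>"] ballI image_subsetI)
      (simp_all add: fun_eq_iff bij_comp bij_is_inj bij_is_surj surj_f_inv_f)
  from sum.reindex_bij_betw[OF this, of "\<lambda>\<sigma>. fam_prod (a \<circ> \<sigma>) UNIV f"]
  show "orb (a \<circ> \<tau>) f = orb a f" by (simp add: orb_def o_assoc)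
qed

lemma weyl_apply_sum: "D \<in> weyl \<Longrightarrow> D (\<Sum>x\<in>A. g x) = (\<Sum>x\<in>A. D (g x))"
  by (induction A rule: infinite_finite_induct) (simp_all add: weyl_0 weyl_add)

text \<open>In the summand for \<sigma> the operator \<open>w j\<close> merges with the family
  \<open>a (\<sigma> j)\<close>. Reindexing by \<sigma> sorts the terms according to the family that
  is hit.\<close>

lemma trace_orb:
  fixes a :: "'n::finite \<Rightarrow> 'n \<Rightarrow> 'n oper"
  assumes "fams a" "w \<in> fam d"
  shows "(\<Sum>j\<in>UNIV. w j (orb a f)) = (\<Sum>i\<in>UNIV. orb (a(i := \<lambda>j f. w j (a i j f))) f)"
proof -
  define b where "b i = a(i := \<lambda>j f. w j (a i j f))" for i
  have *: "w j (fam_prod (a \<circ> \<sigma>) UNIV f) = fam_prod (b (\<sigma> j) \<circ> \<sigma>) UNIV f" if "bij \<sigma>" for j \<sigma>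
  proof -
    have "(a \<circ> \<sigma>)(j := \<lambda>i f. w i ((a \<circ> \<sigma>) j i f)) = b (\<sigma> j) \<circ> \<sigma>"
      using bij_is_inj[OF that] by (simp add: fun_eq_iff b_def inj_eq)
    moreover have "w j (fam_prod (a \<circ> \<sigma>) UNIV f) =
        fam_prod ((a \<circ> \<sigma>)(j := \<lambda>i f. w i ((a \<circ> \<sigma>) j i f))) UNIV f"
      by (rule fam_comp_fam_prod[OF fams_comp[OF assms(1)] assms(2)])
    ultimately show ?thesis by (simp only:)
  qed
  have "(\<Sum>j\<in>UNIV. w j (orb a f)) =
      (\<Sum>j\<in>UNIV. \<Sum>\<sigma> | bij \<sigma>. fam_prod (b (\<sigma> j) \<circ> \<sigma>) UNIV f)"
    by (simp add: orb_def weyl_apply_sum[OF fam_weyl[OF assms(2)]] *)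
  also have "\<dots> = (\<Sum>\<sigma> | bij \<sigma>. \<Sum>j\<in>UNIV. fam_prod (b (\<sigma> j) \<circ> \<sigma>) UNIV f)"
    by (rule sum.swap)
  also have "\<dots> = (\<Sum>\<sigma> | bij \<sigma>. \<Sum>i\<in>UNIV. fam_prod (b i \<circ> \<sigma>) UNIV f)"
  proof (rule sum.cong[OF refl])
    fix \<sigma> :: "'n \<Rightarrow> 'n" assume "\<sigma> \<in> {\<sigma>. bij \<sigma>}"
    then show "(\<Sum>j\<in>UNIV. fam_prod (b (\<sigma> j) \<circ> \<sigma>) UNIV f) =
        (\<Sum>i\<in>UNIV. fam_prod (b i \<circ> \<sigma>) UNIV f)"
      using sum.reindex_bij_betw[of \<sigma> UNIV UNIV "\<lambda>i. fam_prod (b i \<circ> \<sigma>) UNIV f"] by simp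
  qed
  also have "\<dots> = (\<Sum>i\<in>UNIV. \<Sum>\<sigma> | bij \<sigma>. fam_prod (b i \<circ> \<sigma>) UNIV f)"
    by (rule sum.swap)
  finally show ?thesis by (simp add: orb_def b_def)
qed

subsection \<open>Generation by power sums\<close>

text \<open>The parameter bounds the order of the generators, not of the operators: compositions
  stay at the same \<open>d\<close>.\<close>

inductive_set alg :: "nat \<Rightarrow> 'n::finite oper set" for d where
  scalar: "(\<lambda>f. Const c * f) \<in> alg d"
| V: "q \<le> d \<Longrightarrow> V p q \<in> alg d"
| add: "D \<in> alg d \<Longrightarrow> E \<in> alg d \<Longrightarrow> (\<lambda>f. D f + E f) \<in> alg d"
| comp: "D \<in> alg d \<Longrightarrow> E \<in> alg d \<Longrightarrow> (\<lambda>f. D (E f)) \<in> alg d"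

lemma alg_mono: "D \<in> alg d \<Longrightarrow> d \<le> e \<Longrightarrow> D \<in> alg e"
  by (induction rule: alg.induct) (auto intro: alg.intros)

lemma alg_scale: "D \<in> alg d \<Longrightarrow> (\<lambda>f. Const c * D f) \<in> alg d"
  using alg.comp[OF alg.scalar] .

lemma alg_diff: "D \<in> alg d \<Longrightarrow> E \<in> alg d \<Longrightarrow> (\<lambda>f. D f - E f) \<in> alg d"
  using alg.add[of D d "\<lambda>f. Const (-1) * E f"] alg_scale[of E d "-1"]
  by (simp add: Const_uminus)

lemma alg_sum: "(\<And>x. x \<in> A \<Longrightarrow> D x \<in> alg d) \<Longrightarrow> (\<lambda>f. \<Sum>x\<in>A. D x f) \<in> alg d"
proof (induction A rule: infinite_finite_induct)
  case (insert x A)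
  then show ?case using alg.add[of "D x" d "\<lambda>f. \<Sum>x\<in>A. D x f"] by simp
qed (use alg.scalar[of 0] in \<open>simp_all add: lambda_zero\<close>)

lemma alg_cancel_of_nat:
  assumes "(\<lambda>f. of_nat n * D f) \<in> alg d" "n \<noteq> 0"
  shows "D \<in> alg d"
proof -
  have "Const (1 / of_nat n) * (of_nat n * D f) = D f" for f
    using assms(2) by (simp flip: mult.assoc Const_of_nat Const_mult)
  then show ?thesis using alg_scale[OF assms(1), of "1 / of_nat n"] by simp
qed

lemma trace_alg: "w \<in> fam d \<Longrightarrow> (\<lambda>f. \<Sum>j\<in>UNIV. w j f) \<in> alg d"
proof (induction rule: fam.induct)
  case (monom q c p)
  have "(\<lambda>f. Const c * V p q f) \<in> alg d" using monom by (intro alg_scale alg.V)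
  then show ?case by (simp add: V_def sum_distrib_left)
next
  case (add v w)
  from alg.add[OF add.IH] show ?case by (simp add: sum.distrib)
qed

text \<open>
  Induction on the number of nontrivial factors: composing the symmetrization of \<open>a\<close> without its
  factor \<open>w\<close> with \<open>\<Sum>\<^sub>j w\<^sub>j\<close> puts \<open>w\<close> either on a trivial factor, which gives the symmetrization of
  \<open>a\<close>, or on a nontrivial one.
\<close>

lemma orb_alg:
  fixes a :: "'n::finite \<Rightarrow> 'n \<Rightarrow> 'n oper"
  assumes "\<And>i. a i \<in> fam (e i)" "(\<Sum>i\<in>UNIV. e i) \<le> d"
  shows "orb a \<in> alg d"
  using assms
proof (induction "card {i. a i \<noteq> (\<lambda>j f. f)}" arbitrary: a e rule: less_induct)
  case less
  let ?I = "\<lambda>j f. f :: 'n cpoly"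
  show ?case
  proof (cases "\<exists>i. a i \<noteq> ?I")
    case False
    then have a: "a = (\<lambda>i. ?I)" by auto
    have "orb a = (\<lambda>f. Const (of_nat (card {\<sigma> :: 'n \<Rightarrow> 'n. bij \<sigma>})) * f)"
      by (simp add: fun_eq_iff a orb_trivial Const_of_nat)
    then show ?thesis using alg.scalar by metis
  next
    case True
    then obtain i0 where i0: "a i0 \<noteq> ?I" by blast
    define a' where "a' = a(i0 := ?I)"
    define S where "S = {i. a' i \<noteq> ?I}"
    have supp: "{i. a i \<noteq> ?I} = insert i0 S" "i0 \<notin> S"
      using i0 by (auto simp: S_def a'_def)
    let ?b = "\<lambda>i. a'(i := \<lambda>j f. a i0 j (a' i j f))"
    have a'_fam: "a' i \<in> fam ((e(i0 := 0)) i)" for i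
      using less.prems(1) by (simp add: a'_def fam_id)
    have sum_e: "(\<Sum>i\<in>UNIV. e i) = e i0 + (\<Sum>i\<in>UNIV. (e(i0 := 0)) i)"
      by (simp add: sum.remove[of UNIV i0])
    have orb_a': "orb a' \<in> alg d"
    proof (rule less.hyps[OF _ a'_fam])
      show "card {i. a' i \<noteq> ?I} < card {i. a i \<noteq> ?I}"
        unfolding supp using supp(2) by (simp add: S_def)
    qed (use sum_e less.prems(2) in linarith)
    have "e i0 \<le> d" using sum_e less.prems(2) by linarith
    then have "(\<lambda>f. \<Sum>j\<in>UNIV. a i0 j f) \<in> alg d"
      using alg_mono[OF trace_alg] less.prems(1) by blast
    then have "(\<lambda>f. \<Sum>j\<in>UNIV. a i0 j (orb a' f)) \<in> alg d"
      using alg.comp orb_a' by fast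
    moreover have "(\<Sum>j\<in>UNIV. a i0 j (orb a' f)) = (\<Sum>i\<in>UNIV. orb (?b i) f)" for f
      using a'_fam by (intro trace_orb) (auto intro: less.prems(1))
    ultimately have 1: "(\<lambda>f. \<Sum>i\<in>UNIV. orb (?b i) f) \<in> alg d" by simp
    have "orb (?b i) \<in> alg d" if "i \<in> S" for i
    proof (rule less.hyps)
      have "i \<noteq> i0" using that supp(2) by auto
      have "{l. ?b i l \<noteq> ?I} \<subseteq> S" using that by (auto simp: S_def)
      then have "card {l. ?b i l \<noteq> ?I} \<le> card S" by (intro card_mono) auto
      then show "card {l. ?b i l \<noteq> ?I} < card {i. a i \<noteq> ?I}"
        unfolding supp using supp(2) by simp
      \<comment> \<open>The order of \<open>a i0\<close> is transferred to position
        \<open>i\<close>, so the total bound is unchanged.\<close>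
      let ?e = "(e(i0 := 0))(i := e i0 + e i)"
      show "?b i l \<in> fam (?e l)" for l
        using a'_fam[of l] fam_comp[OF less.prems(1)[of i0] a'_fam[of i]] \<open>i \<noteq> i0\<close> by auto
      have "(\<Sum>i\<in>UNIV. ?e i) = e i0 + (\<Sum>i\<in>UNIV. (e(i0 := 0)) i)"
        using \<open>i \<noteq> i0\<close> by (simp add: sum.remove[of UNIV i])
      then show "(\<Sum>i\<in>UNIV. ?e i) \<le> d" using sum_e less.prems(2) by linarith
    qed
    then have 2: "(\<lambda>f. \<Sum>i\<in>S. orb (?b i) f) \<in> alg d" by (rule alg_sum)
    have eq: "orb (?b i) = orb a" if "i \<notin> S" for i
    proof -
      have "a' i = ?I" using that by (simp add: S_def)
      then have "?b i = a \<circ> transpose i i0"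
        by (auto simp: fun_eq_iff a'_def transpose_def)
      then show ?thesis using orb_relabel[of "transpose i i0" a] by simp
    qed
    have "(\<Sum>i\<in>UNIV. orb (?b i) f) = (\<Sum>i\<in>S. orb (?b i) f) + of_nat (card (- S)) * orb a f" for f
      by (subst sum.subset_diff[of S]) (simp_all add: eq Compl_eq_Diff_UNIV)
    then have "(\<lambda>f. of_nat (card (- S)) * orb a f) \<in> alg d"
      using alg_diff[OF 1 2] by simp
    \<comment> \<open>The position \<open>i0\<close> itself is free in \<open>a'\<close>, so
      \<open>orb a\<close> occurs with a nonzero coefficient.\<close>
    moreover have "card (- S) \<noteq> 0" using supp(2) by auto
    ultimately show ?thesis by (rule alg_cancel_of_nat)
  qed
qed

section \<open>From invariant operators to symmetrized products\<close>

inductive_set fam_prods :: "'n::finite oper set" where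
  prod: "fams a \<Longrightarrow> fam_prod a UNIV \<in> fam_prods"
| add: "D \<in> fam_prods \<Longrightarrow> E \<in> fam_prods \<Longrightarrow> (\<lambda>f. D f + E f) \<in> fam_prods"

lemma fam_comp_fam_prods:
  fixes w :: "'n::finite \<Rightarrow> 'n oper"
  assumes "w \<in> fam d" "E \<in> fam_prods"
  shows "w j \<circ> E \<in> fam_prods"
  using assms(2)
proof (induction rule: fam_prods.induct)
  case (prod a)
  have "w j \<circ> fam_prod a UNIV = fam_prod (a(j := \<lambda>i f. w i (a j i f))) UNIV"
    by (simp add: fun_eq_iff fam_comp_fam_prod[OF prod assms(1)])
  then show ?case using fam_prods.prod[OF fams_upd_comp[OF prod assms(1)], of j] by (simp only:)
next
  case (add D E)
  from fam_prods.add[OF add.IH] show ?case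
    by (simp add: o_def weyl_add[OF fam_weyl[OF assms(1)]])
qed

text \<open>The right factor \<open>E\<close> reduces the case of a composition to associativity:
  generators are absorbed into \<open>E\<close> one by one.\<close>

lemma weyl_comp_fam_prods:
  fixes D :: "'n::finite oper"
  assumes "D \<in> weyl" "E \<in> fam_prods"
  shows "D \<circ> E \<in> fam_prods"
  using assms
proof (induction arbitrary: E rule: weyl.induct)
  case (scalar c)
  have "(\<lambda>(j :: 'n) f. Const c * f) \<in> fam 0" using fam.monom[of 0 0 c 0] by simp
  from fam_comp_fam_prods[OF this scalar] show ?case .
next
  case (var j)
  have "(\<lambda>j f. Var j * f) \<in> fam 0" using fam_monom[of 0 0 1] by simp
  from fam_comp_fam_prods[OF this var] show ?case .
next
  case (pd j)
  from fam_comp_fam_prods[OF fam_pd[OF order_refl] pd] show ?case .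
next
  case (add D D')
  show ?case using fam_prods.add[OF add.IH[OF add.prems]] by (simp add: o_def)
next
  case (mult D D')
  then show ?case by (simp add: comp_assoc)
qed

lemma weyl_fam_prods:
  fixes D :: "'n::finite oper"
  assumes "D \<in> weyl"
  shows "D \<in> fam_prods"
proof -
  have "fam_prod (\<lambda>i j f. f) UNIV \<in> (fam_prods :: 'n oper set)"
    by (rule fam_prods.prod) (use fam_id in blast)
  then have "(\<lambda>f. f) \<in> (fam_prods :: 'n oper set)" by (simp add: fam_prod_trivial)
  from weyl_comp_fam_prods[OF assms this] show ?thesis by (simp add: o_def)
qed

text \<open>Averaging over all permutations turns each product into its symmetrization, which
  \<open>orb_alg\<close> handles, and multiplies an invariant operator by the number of
  permutations.\<close>

lemma weyl_sym_alg:
  fixes D :: "'n::finite oper"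
  assumes "D \<in> weyl_sym"
  shows "\<exists>d. D \<in> alg d"
proof -
  let ?av = "\<lambda>D f. \<Sum>\<sigma> | bij \<sigma>. perm (inv \<sigma>) (D (perm \<sigma> f)) :: 'n cpoly"
  have "D \<in> fam_prods" using assms by (simp add: weyl_sym_weyl weyl_fam_prods)
  then have "\<exists>d. ?av D \<in> alg d"
  proof (induction rule: fam_prods.induct)
    case (prod a)
    have "?av (fam_prod a UNIV) f = orb a f" for f
    proof -
      have "perm (inv \<sigma>) (fam_prod a UNIV (perm \<sigma> f)) = fam_prod (a \<circ> \<sigma>) UNIV f"
        if "bij \<sigma>" for \<sigma>
        using that perm_fam_prod[OF prod bij_imp_bij_inv[OF that]]
        by (simp add: inv_inv_eq perm_inv_perm)
      then show ?thesis by (simp add: orb_def)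
    qed
    moreover obtain e where "\<And>i. a i \<in> fam (e i)" using prod by metis
    then have "orb a \<in> alg (\<Sum>i\<in>UNIV. e i)" by (rule orb_alg) simp
    ultimately show ?case by auto
  next
    case (add D E)
    then obtain d e where "?av D \<in> alg d" "?av E \<in> alg e" by blast
    then have "?av D \<in> alg (max d e)" "?av E \<in> alg (max d e)"
      by (auto intro: alg_mono)
    from alg.add[OF this] show ?case
      by (auto simp: perm_add bij_imp_bij_inv sum.distrib)
  qed
  moreover have "?av D = (\<lambda>f. of_nat (card {\<sigma> :: 'n \<Rightarrow> 'n. bij \<sigma>}) * D f)"
  proof
    fix f
    have "perm (inv \<sigma>) (D (perm \<sigma> f)) = D f" if "bij \<sigma>" for \<sigma>
      using assms that by (metis weyl_sym_iff perm_inv_perm)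
    then show "?av D f = of_nat (card {\<sigma> :: 'n \<Rightarrow> 'n. bij \<sigma>}) * D f" by simp
  qed
  ultimately show ?thesis using alg_cancel_of_nat card_bij_nonzero by metis
qed

subsection \<open>Reduction of the exponents\<close>

text \<open>
  Let \<open>b\<^sub>S\<close> have the factor \<open>z\<^sup>p \<partial>\<^bsup>q - |S|\<^esup>\<close> at \<open>i\<close> and the factors \<open>\<partial>\<close> on \<open>S \<noteq> UNIV\<close>. Composing the
  symmetrization of \<open>\<partial>\<close> on \<open>insert i S\<close> with \<open>V p (q - |S| - 1)\<close> relates \<open>b\<^sub>S\<close> to \<open>b\<^sub>T\<close> for larger \<open>T\<close>,
  so we descend from \<open>S = UNIV\<close>, where there is no room for \<open>i\<close>, to \<open>S = {}\<close>.
\<close>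

lemma V_high_order:
  assumes q: "CARD('n::finite) < q"
  shows "(V p q :: 'n oper) \<in> alg (q - 1)"
proof -
  let ?I = "\<lambda>j f. f :: 'n cpoly"
  define m :: "nat \<Rightarrow> 'n \<Rightarrow> 'n oper" where "m r = (\<lambda>j f. Var j ^ p * (pd j ^^ r) f)" for r
  define D where "D S = (\<lambda>i :: 'n. if i \<in> S then pd else ?I)" for S
  have m_fam: "m r \<in> fam d" if "r \<le> d" for r d
    unfolding m_def by (rule fam_monom[OF that])
  have D_fam: "D S i \<in> fam (if i \<in> S then 1 else 0)" for S i
    by (simp add: D_def fam_id fam_pd)
  then have D_fams: "fams (D S)" for S by blast
  have "orb ((D S)(i0 := m (q - card S))) \<in> alg (q - 1)"
    if "card S + n = CARD('n)" "i0 \<notin> S" for n i0 S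
    using that
  proof (induction n arbitrary: i0 S)
    case 0
    then have "S = UNIV" by (intro card_subset_eq) auto
    then show ?case using 0 by simp
  next
    case (Suc n)
    define S' where "S' = insert i0 S"
    have card: "card S' = Suc (card S)" "card S' + n = CARD('n)"
      using Suc.prems by (simp_all add: S'_def)
    let ?r = "q - card S'"
    let ?b = "\<lambda>i. (D S')(i := \<lambda>j f. m ?r j (D S' i j f))"
    have "orb (D S') \<in> alg (q - 1)"
    \<comment> \<open>The total order is the size of \<open>S'\<close>, at most the number of
      variables and hence below \<open>q\<close>.\<close>
    proof (rule orb_alg[OF D_fam])
      show "(\<Sum>i\<in>UNIV. if i \<in> S' then 1 else 0) \<le> q - 1"
        using card q by (simp add: sum.If_cases)
    qed
    moreover have "(\<lambda>f. \<Sum>j\<in>UNIV. m ?r j f) \<in> alg (q - 1)"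
      using card by (intro trace_alg m_fam) simp
    ultimately have "(\<lambda>f. \<Sum>j\<in>UNIV. m ?r j (orb (D S') f)) \<in> alg (q - 1)"
      using alg.comp by fast
    then have 1: "(\<lambda>f. \<Sum>i\<in>UNIV. orb (?b i) f) \<in> alg (q - 1)"
      by (simp add: trace_orb[OF D_fams m_fam[OF order_refl]])
    have "orb (?b i) \<in> alg (q - 1)" if "i \<notin> S'" for i
    proof -
      have "?b i = (D S')(i := m ?r)" using that by (simp add: D_def)
      then show ?thesis using Suc.IH[OF card(2) that] by (simp only:)
    qed
    then have 2: "(\<lambda>f. \<Sum>i\<in>- S'. orb (?b i) f) \<in> alg (q - 1)" by (intro alg_sum) auto
    let ?a = "(D S)(i0 := m (q - card S))"
    \<comment> \<open>Landing on a factor \<open>pd\<close> raises the order back to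
      \<open>q - card S\<close>. All positions in \<open>S'\<close> then give the same product up to
      relabelling.\<close>
    have eq: "orb (?b i) = orb ?a" if "i \<in> S'" for i
    proof -
      have "q - card S = Suc ?r" using card q by simp
      then have "(\<lambda>j f. m ?r j (D S' i j f)) = m (q - card S)"
        using that by (simp add: D_def m_def funpow_swap1)
      then have "?b i = ?a \<circ> transpose i i0"
        using that by (auto simp: fun_eq_iff D_def S'_def transpose_def)
      then show ?thesis using orb_relabel[of "transpose i i0" ?a] by simp
    qed
    have "(\<Sum>i\<in>UNIV. orb (?b i) f) =
        (\<Sum>i\<in>- S'. orb (?b i) f) + of_nat (card S') * orb ?a f" for f
      by (subst sum.subset_diff[of "- S'"]) (simp_all add: eq double_complement flip: Compl_eq_Diff_UNIV)
    then have "(\<lambda>f. of_nat (card S') * orb ?a f) \<in> alg (q - 1)"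
      using alg_diff[OF 1 2] by simp
    then show ?case by (rule alg_cancel_of_nat) (simp add: card)
  qed
  from this[of "{}" "CARD('n)"]
  have "orb ((\<lambda>i. ?I)(i := m q)) \<in> alg (q - 1)" for i by (simp add: D_def)
  then have "(\<lambda>f. \<Sum>i\<in>UNIV. orb ((\<lambda>i. ?I)(i := m q)) f) \<in> alg (q - 1)" by (rule alg_sum)
  \<comment> \<open>The case of empty \<open>S\<close>: one factor \<open>m q\<close> among trivial
    ones, which by \<open>trace_orb\<close> is \<open>V p q\<close> composed with a nonzero
    scalar.\<close>
  moreover have "(\<Sum>i\<in>UNIV. orb ((\<lambda>i. ?I)(i := m q)) f) =
      of_nat (card {\<sigma> :: 'n \<Rightarrow> 'n. bij \<sigma>}) * V p q f" for f
  proof -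
    have "(\<Sum>i\<in>UNIV. orb ((\<lambda>i. ?I)(i := m q)) f) = (\<Sum>j\<in>UNIV. m q j (orb (\<lambda>i. ?I) f))"
      using fam_id by (intro trace_orb[OF _ m_fam[OF order_refl], symmetric]) blast
    also have "\<dots> = V p q (orb (\<lambda>i. ?I) f)" by (simp add: V_def m_def)
    finally show ?thesis
      by (simp add: orb_trivial weyl_Const_mult[OF weyl_V] flip: Const_of_nat)
  qed
  ultimately show ?thesis using alg_cancel_of_nat[OF _ card_bij_nonzero] by simp
qed

text \<open>Each variable is a root of the monic polynomial whose roots are all the variables. Its
  coefficients are symmetric, do not depend on \<open>j\<close>, and so factor out of the sum on the
  left.\<close>

lemma V_high_degree:
  obtains c :: "nat \<Rightarrow> 'n::finite cpoly"
  where "\<And>t. symmetric_poly (c t)"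
    and "\<And>r q f. V (CARD('n) + r) q f = (\<Sum>t<CARD('n). c t * V (t + r) q f)"
proof
  \<comment> \<open>Expanding the product of all \<open>x - Var i\<close>, let \<open>X\<close> be
    the set of factors contributing \<open>x\<close>. The others contribute \<open>e X\<close>, so
    the coefficient at \<open>x ^ t\<close> is \<open>- c t\<close>.\<close>
  define e where "e X = (\<Prod>i\<in>- X. - Var i)" for X :: "'n set"
  define c where "c t = - (\<Sum>X | card X = t. e X)" for t
  show "symmetric_poly (c t)" for t
    unfolding symmetric_poly_def
  proof (intro allI impI)
    fix \<sigma> :: "'n \<Rightarrow> 'n" assume \<sigma>: "bij \<sigma>"
    have "perm \<sigma> (e X) = e (\<sigma> ` X)" for X
    proof -
      have "perm \<sigma> (e X) = (\<Prod>i\<in>- X. - Var (\<sigma> i))"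
        by (simp add: e_def perm_prod perm_uminus perm_Var \<sigma>)
      also have "\<dots> = (\<Prod>i\<in>\<sigma> ` (- X). - Var i)"
        using \<sigma> by (subst prod.reindex) (auto intro: inj_on_subset[OF bij_is_inj])
      finally show ?thesis using \<sigma> by (simp add: e_def bij_image_Compl_eq)
    qed
    moreover have "bij_betw ((`) \<sigma>) {X. card X = t} {X. card X = t}"
      using \<sigma> bij_imp_bij_inv[OF \<sigma>]
      by (intro bij_betw_byWitness[where f' = "(`) (inv \<sigma>)"])
        (auto simp: image_image bij_is_inj bij_is_surj surj_f_inv_f card_image
          inj_on_subset[OF bij_is_inj])
    from sum.reindex_bij_betw[OF this, of e]
    have "(\<Sum>X | card X = t. e (\<sigma> ` X)) = (\<Sum>X | card X = t. e X)" .
    ultimately show "perm \<sigma> (c t) = c t"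
      by (simp add: c_def perm_uminus perm_sum \<sigma>)
  qed
  have Var_power: "Var j ^ CARD('n) = (\<Sum>t<CARD('n). c t * Var j ^ t)" for j
  proof -
    have "0 = (\<Prod>i\<in>UNIV. Var j + - Var i)" by (intro prod_zero[symmetric]) auto
    also have "\<dots> = (\<Sum>X\<in>UNIV. Var j ^ card X * e X)"
      by (subst prod_add) (simp_all add: e_def Compl_eq_Diff_UNIV)
    also have "\<dots> = (\<Sum>t\<le>CARD('n). \<Sum>X | X \<in> UNIV \<and> card X = t. Var j ^ card X * e X)"
      by (rule sum.group[symmetric]) (auto intro: card_mono)
    also have "\<dots> = (\<Sum>t\<le>CARD('n). - c t * Var j ^ t)"
      by (intro sum.cong refl)
        (simp add: c_def sum_distrib_left mult.commute[of "sum e _"])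
    also have "\<dots> = - c CARD('n) * Var j ^ CARD('n) - (\<Sum>t<CARD('n). c t * Var j ^ t)"
      by (simp add: lessThan_Suc_atMost[symmetric] sum_negf)
    also have "{X :: 'n set. card X = CARD('n)} = {UNIV}"
      using card_subset_eq[OF finite subset_UNIV] by blast
    then have "- c CARD('n) = 1" by (simp add: c_def e_def)
    finally show ?thesis by simp
  qed
  show "V (CARD('n) + r) q f = (\<Sum>t<CARD('n). c t * V (t + r) q f)" for r q f
  proof -
    have "V (CARD('n) + r) q f =
        (\<Sum>j\<in>UNIV. \<Sum>t<CARD('n). c t * (Var j ^ (t + r) * (pd j ^^ q) f))"
      by (simp add: V_def power_add Var_power sum_distrib_right mult.assoc)
    also have "\<dots> = (\<Sum>t<CARD('n). \<Sum>j\<in>UNIV. c t * (Var j ^ (t + r) * (pd j ^^ q) f))"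
      by (rule sum.swap)
    finally show ?thesis by (simp add: V_def sum_distrib_left)
  qed
qed

subsection \<open>Operators acting on products of power sums\<close>

definition psum :: "nat \<Rightarrow> 'n::finite cpoly" where
  "psum a = (\<Sum>j\<in>UNIV. Var j ^ a)"

lemma symmetric_poly_psum: "symmetric_poly (psum a)"
  unfolding symmetric_poly_def psum_def
proof (intro allI impI)
  fix \<sigma> :: "'a \<Rightarrow> 'a" assume \<sigma>: "bij \<sigma>"
  have "perm \<sigma> (\<Sum>j\<in>UNIV. Var j ^ a) = (\<Sum>j\<in>UNIV. Var (\<sigma> j) ^ a)"
    by (simp add: perm_sum perm_power perm_Var \<sigma>)
  also have "\<dots> = (\<Sum>j\<in>UNIV. Var j ^ a)" by (rule sum.reindex_bij_betw[OF \<sigma>])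
  finally show "perm \<sigma> (\<Sum>j\<in>UNIV. Var j ^ a) = (\<Sum>j\<in>UNIV. Var j ^ a)" .
qed

lemma V_0: "V p 0 f = psum p * f"
  by (simp add: V_def psum_def sum_distrib_right)

inductive_set psum_polys :: "'n::finite cpoly set" where
  Const: "Const c \<in> psum_polys"
| add: "f \<in> psum_polys \<Longrightarrow> g \<in> psum_polys \<Longrightarrow> f + g \<in> psum_polys"
| mult: "g \<in> psum_polys \<Longrightarrow> psum a * g \<in> psum_polys"

lemma psum_polys_Const_mult: "g \<in> psum_polys \<Longrightarrow> Const c * g \<in> psum_polys"
proof (induction rule: psum_polys.induct)
  case (Const b)
  then show ?case using psum_polys.Const[of "c * b"] by (simp add: Const_mult)
qed (simp_all add: distrib_left mult.left_commute[of "Const c"] psum_polys.intros)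

lemma pd_psum: "pd j (psum a) = of_nat a * Var j ^ (a - 1)"
proof -
  have "pd j (psum a) = (\<Sum>i\<in>UNIV. if j = i then of_nat a * Var i ^ (a - 1) else 0)"
    unfolding psum_def pd_sum by (intro sum.cong) (auto simp: pd_Var_power)
  then show ?thesis by simp
qed

text \<open>Iterated product rule; derivatives that hit the power sum leave powers of the same
  variable \<open>j\<close>, so the remainder is again a family. The bound \<open>q\<close> on its
  order suffices because the later induction runs over the polynomial.\<close>

lemma V_psum_mult:
  obtains w :: "'n::finite \<Rightarrow> 'n oper"
  where "w \<in> fam q" "\<And>f. V p q (psum a * f) = psum a * V p q f + (\<Sum>j\<in>UNIV. w j f)"
proof -
  have "\<exists>r \<in> fam q. \<forall>(j :: 'n) f. (pd j ^^ q) (psum a * f) = psum a * (pd j ^^ q) f + r j f"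
  proof (induction q)
    case 0
    have "(\<lambda>(j :: 'n) f. 0) \<in> fam 0" using fam.monom[of 0 0 0 0] by simp
    then show ?case by force
  next
    case (Suc q)
    then obtain r where r: "r \<in> fam q"
      "\<And>(j :: 'n) f. (pd j ^^ q) (psum a * f) = psum a * (pd j ^^ q) f + r j f"
      by blast
    have "(\<lambda>(j :: 'n) f. Const (of_nat a) * (Var j ^ (a - 1) * (pd j ^^ q) f) + pd j (r j f)) \<in> fam (Suc q)"
      by (intro fam.add fam.monom fam_pd_comp r) simp
    moreover have "(pd j ^^ Suc q) (psum a * f) = psum a * (pd j ^^ Suc q) f +
        (Const (of_nat a) * (Var j ^ (a - 1) * (pd j ^^ q) f) + pd j (r j f))" for j :: 'n and f
      by (simp only: funpow.simps o_apply r(2))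
        (simp add: pd_add pd_mult pd_psum Const_of_nat algebra_simps)
    ultimately show ?case by (intro bexI allI)
  qed
  then obtain r where r: "r \<in> fam q"
    "\<And>(j :: 'n) f. (pd j ^^ q) (psum a * f) = psum a * (pd j ^^ q) f + r j f"
    by blast
  show ?thesis
  proof (rule that)
    show "(\<lambda>j f. Var j ^ p * r j f) \<in> fam q" by (rule fam_Var_power_mult[OF r(1)])
  qed (simp add: V_def r(2) distrib_left sum.distrib sum_distrib_left mult.left_commute)
qed

text \<open>
  The parameter \<open>T\<close> covers both the composition with multiplication operators (\<open>T = id\<close>) and the
  values on polynomials (\<open>T\<close> constantly \<open>1\<close>).
\<close>

lemma V_psum_polys_induct:
  fixes Q :: "'n::finite oper set"
  assumes add: "\<And>D E. D \<in> Q \<Longrightarrow> E \<in> Q \<Longrightarrow> (\<lambda>f. D f + E f) \<in> Q"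
    and Const: "\<And>D c. D \<in> Q \<Longrightarrow> (\<lambda>f. Const c * D f) \<in> Q"
    and psum: "\<And>D a. D \<in> Q \<Longrightarrow> (\<lambda>f. psum a * D f) \<in> Q"
    and base: "\<And>p q. q \<le> d \<Longrightarrow> (\<lambda>f. V p q (T f)) \<in> Q"
    and g: "g \<in> psum_polys" and q: "q \<le> d"
  shows "(\<lambda>f. V p q (g * T f)) \<in> Q"
  using g q
proof (induction arbitrary: p q rule: psum_polys.induct)
  case (Const c)
  then show ?case using assms(2)[OF base] by (simp add: weyl_Const_mult[OF weyl_V])
next
  case (add g h)
  then show ?case using assms(1)[OF add.IH]
    by (simp add: distrib_right weyl_add[OF weyl_V])
next
  case (mult g a)
  obtain w :: "'n \<Rightarrow> 'n oper" where w: "w \<in> fam q"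
    "\<And>f. V p q (psum a * f) = psum a * V p q f + (\<Sum>j\<in>UNIV. w j f)"
    by (rule V_psum_mult[of q p a]) blast
  have "(\<lambda>f. \<Sum>j\<in>UNIV. w j (g * T f)) \<in> Q"
    using w(1)
  proof (induction rule: fam.induct)
    case (monom q' c p')
    then have "(\<lambda>f. Const c * V p' q' (g * T f)) \<in> Q"
      using mult.prems by (intro assms(2) mult.IH) simp
    then show ?case by (simp add: V_def sum_distrib_left)
  next
    case (add v w)
    from assms(1)[OF add.IH] show ?case by (simp add: sum.distrib)
  qed
  from assms(1)[OF psum[OF mult.IH[OF mult.prems]] this]
  show ?case by (simp add: mult.assoc w(2))
qed

lemma alg_psum_polys:
  fixes g :: "'n::finite cpoly"
  assumes "D \<in> alg d" "g \<in> psum_polys"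
  shows "D g \<in> psum_polys"
  using assms
proof (induction arbitrary: g rule: alg.induct)
  case (V q p)
  have "(\<lambda>f :: 'n cpoly. V p q (g * 1)) \<in> {X. \<forall>f. X f \<in> psum_polys}"
  proof (rule V_psum_polys_induct[where T = "\<lambda>f. 1"])
    fix p q
    have "(pd j ^^ Suc q) 1 = 0" for j :: 'n and q
      using pd_Const[of j 1] by (induction q) auto
    \<comment> \<open>Derivatives annihilate 1, so only order 0 contributes, and it gives a power
      sum.\<close>
    then have "V p q (1 :: 'n cpoly) = (if q = 0 then psum p * Const 1 else 0)"
      by (cases q) (auto simp: psum_def V_def simp del: funpow.simps)
    then show "(\<lambda>f. V p q 1) \<in> {X. \<forall>f :: 'n cpoly. X f \<in> (psum_polys :: 'n cpoly set)}"
      using psum_polys.mult[OF psum_polys.Const[of 1], where 'n = 'n, of p]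
        psum_polys.Const[of 0, where 'n = 'n] by simp
  qed (use V in \<open>auto intro: psum_polys.intros psum_polys_Const_mult\<close>)
  then show ?case by simp
qed (auto intro: psum_polys.add psum_polys_Const_mult)

text \<open>Power sums generate the symmetric polynomials: multiplication by \<open>g\<close> is an
  invariant operator, hence lies in some \<open>alg d\<close>, and its value at 1 is
  \<open>g\<close>.\<close>

lemma symmetric_psum_polys:
  fixes g :: "'n::finite cpoly"
  assumes "symmetric_poly g"
  shows "g \<in> psum_polys"
proof -
  obtain d where "(\<lambda>f. g * f) \<in> alg d"
    using weyl_sym_alg[OF weyl_sym_mult_poly[OF assms]] by blast
  from alg_psum_polys[OF this psum_polys.Const[of 1]] show ?thesis by simp
qed

section \<open>The annihilator of the Vandermonde polynomial\<close>

lemma left_ideal_Int: "left_ideal A I \<Longrightarrow> left_ideal A J \<Longrightarrow> left_ideal A (I \<inter> J)"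
  by (auto simp: left_ideal_def)

lemma left_ideal_annihilator:
  fixes v :: "'n::finite cpoly"
  shows "left_ideal weyl_sym {D \<in> weyl_sym. D v = 0}"
proof -
  have "(\<lambda>f. 0) \<in> (weyl_sym :: 'n oper set)"
    using weyl_sym_mult_poly[OF symmetric_poly_Const[of 0]] by (simp add: lambda_zero)
  moreover have "D \<circ> E \<in> weyl_sym \<and> (D \<circ> E) v = 0"
    if "D \<in> weyl_sym" "E \<in> weyl_sym" "E v = 0" for D E
    using that weyl_0[OF weyl_sym_weyl[OF that(1)]] by (simp add: weyl_sym_comp)
  ultimately show ?thesis
    by (auto simp: left_ideal_def weyl_sym_add)
qed

text \<open>The left ideal \<open>J\<close> is arbitrary, so that it can later be chosen inside the
  annihilator.\<close>

lemma weyl_sym_decomposition: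
  fixes D :: "'n::{finite,linorder} oper"
  assumes J: "left_ideal weyl_sym J"
    and gens: "{(\<lambda>f. V p q f - u p q * f) | p q. p \<in> {0..CARD('n)} \<and> q \<in> {1..CARD('n)}} \<subseteq> J"
    and D: "D \<in> weyl_sym"
  shows "\<exists>g E. symmetric_poly g \<and> E \<in> J \<and> D = (\<lambda>f. g * f + E f)"
proof -
  define M where "M = {D. \<exists>g E. symmetric_poly g \<and> E \<in> J \<and> D = (\<lambda>f. g * f + E f)}"
  have M_I: "(\<lambda>f. g * f + E f) \<in> M" if "symmetric_poly g" "E \<in> J" for g E
    using that by (auto simp: M_def)
  have J_zero: "(\<lambda>f. 0) \<in> J" and J_add: "\<And>D E. D \<in> J \<Longrightarrow> E \<in> J \<Longrightarrow> (\<lambda>f. D f + E f) \<in> J"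
    and J_comp: "\<And>D E. D \<in> weyl_sym \<Longrightarrow> E \<in> J \<Longrightarrow> (\<lambda>f. D (E f)) \<in> J"
    using J by (auto simp: left_ideal_def o_def)
  have J_M: "E \<in> J \<Longrightarrow> E \<in> M" for E
    using M_I[OF symmetric_poly_Const[of 0]] by simp
  have sym_M: "symmetric_poly g \<Longrightarrow> (\<lambda>f. g * f) \<in> M" for g
    using M_I[OF _ J_zero] by simp
  have M_add: "(\<lambda>f. D f + E f) \<in> M" if "D \<in> M" "E \<in> M" for D E
  proof -
    obtain g D' h E' where "symmetric_poly g" "D' \<in> J" "D = (\<lambda>f. g * f + D' f)"
      "symmetric_poly h" "E' \<in> J" "E = (\<lambda>f. h * f + E' f)"
      using \<open>D \<in> M\<close> \<open>E \<in> M\<close> by (auto simp: M_def)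
    then show ?thesis
      using M_I[OF symmetric_poly_add J_add, of g h D' E'] by (simp add: algebra_simps)
  qed
  have M_sym_mult: "(\<lambda>f. h * D f) \<in> M" if h: "symmetric_poly h" and "D \<in> M" for h D
  proof -
    obtain g D' where "symmetric_poly g" "D' \<in> J" "D = (\<lambda>f. g * f + D' f)"
      using \<open>D \<in> M\<close> by (auto simp: M_def)
    then show ?thesis
      using M_I[OF symmetric_poly_mult[OF h] J_comp[OF weyl_sym_mult_poly[OF h]], of g D']
      by (simp add: algebra_simps)
  qed
  have M_alg_comp: "(\<lambda>f. D (X f)) \<in> M"
    if V_M: "\<And>p q. q \<le> d \<Longrightarrow> V p q \<in> M" and D: "D \<in> alg d" and X: "X \<in> M" for d D X
    using D X
  proof (induction arbitrary: X rule: alg.induct)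
    case (scalar c)
    show ?case by (rule M_sym_mult[OF symmetric_poly_Const scalar])
  next
    case (V q p)
    obtain g E where X: "symmetric_poly g" "E \<in> J" "X = (\<lambda>f. g * f + E f)"
      using \<open>X \<in> M\<close> by (auto simp: M_def)
    \<comment> \<open>As \<open>g\<close> is a polynomial in power sums, \<open>V p q\<close> can be
      moved past it at the cost of terms of order at most \<open>d\<close>, with symmetric
      coefficients on the left.\<close>
    have 1: "(\<lambda>f. V p q (g * f)) \<in> M"
    proof (rule V_psum_polys_induct[where d = d and T = "\<lambda>f. f"])
      show "(\<lambda>f. V p q f) \<in> M" if "q \<le> d" for p q using V_M[OF that] .
    qed (fact M_add M_sym_mult[OF symmetric_poly_Const] M_sym_mult[OF symmetric_poly_psum]
          symmetric_psum_polys[OF X(1)] V(1))+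
    have 2: "(\<lambda>f. V p q (E f)) \<in> M"
      by (rule J_M[OF J_comp[OF weyl_sym_V X(2)]])
    show ?case using M_add[OF 1 2] by (simp add: X(3) weyl_add[OF weyl_V])
  next
    case (add D E)
    show ?case by (rule M_add[OF add.IH(1)[OF add.prems] add.IH(2)[OF add.prems]])
  next
    case (comp D E)
    show ?case by (rule comp.IH(1)[OF comp.IH(2)[OF comp.prems]])
  qed
  have M_alg: "D \<in> M" if "\<And>p q. q \<le> d \<Longrightarrow> V p q \<in> M" "D \<in> alg d" for d D
    using M_alg_comp[OF that sym_M[OF symmetric_poly_Const[of 1]]] by simp
  have V_M: "V p q \<in> M" for p q
  proof (induction q arbitrary: p rule: less_induct)
    case (less q)
    consider "q = 0" | "q \<in> {1..CARD('n)}" | "CARD('n) < q"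
      by (cases "q = 0"; cases "q \<le> CARD('n)") auto
    then show ?case
    proof cases
      case 1
      then show ?thesis using sym_M[OF symmetric_poly_psum[of p]] by (simp add: V_0[abs_def])
    next
      case 2
      obtain c :: "nat \<Rightarrow> 'n cpoly" where c: "\<And>t. symmetric_poly (c t)"
        "\<And>r q f. V (CARD('n) + r) q f = (\<Sum>t<CARD('n). c t * V (t + r) q f)"
        by (rule V_high_degree) blast
      show ?thesis
      proof (induction p rule: less_induct)
        case (less p)
        show ?case
        proof (cases "p \<le> CARD('n)")
          case True
          with 2 have "(\<lambda>f. V p q f - u p q * f) \<in> J"
            by (intro subsetD[OF gens] CollectI exI[of _ p] exI[of _ q]) auto
          from M_I[OF symmetric_poly_u this, of p q] show ?thesis by simp
        next
          case False
          define r where "r = p - CARD('n)"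
          have p: "p = CARD('n) + r" using False by (simp add: r_def)
          \<comment> \<open>Every exponent \<open>t + r\<close> is below \<open>p\<close>, so the
            inner induction on \<open>p\<close> applies termwise.\<close>
          have "(\<lambda>f. \<Sum>t\<in>A. c t * V (t + r) q f) \<in> M" if "A \<subseteq> {..<CARD('n)}" for A
            using finite_subset[OF that finite_lessThan] that
          proof (induction A rule: finite_induct)
            case empty
            show ?case using J_M[OF J_zero] by simp
          next
            case (insert t A)
            then have "t + r < p" by (simp add: p)
            from M_add[OF M_sym_mult[OF c(1) less.IH[OF this]]] insert
            show ?case by simp
          qed
          from this[OF order_refl] show ?thesis by (simp add: p flip: c(2))
        qed
      qed
    next
      case 3
      then have "V p' q' \<in> M" if "q' \<le> q - 1" for p' q'
        using that by (intro less.IH) simp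
      then show ?thesis by (rule M_alg[OF _ V_high_order[OF 3]])
    qed
  qed
  obtain d where "D \<in> alg d" using weyl_sym_alg[OF D] by blast
  with V_M have "D \<in> M" by (rule M_alg)
  then show ?thesis by (simp add: M_def)
qed

theorem proposition2p2p3:
  shows "{D \<in> weyl_sym. D (vandermonde :: 'n::{finite,linorder} cpoly) = 0} =
    left_ideal weyl_sym hull
      {(\<lambda>f. V p q f - u p q * f) | p q. p \<in> {0..CARD('n)} \<and> q \<in> {1..CARD('n)}}"
    (is "?Ann = left_ideal weyl_sym hull ?S")
proof
  have "(\<lambda>f. V p q f - u p q * f) \<in> ?Ann" for p q
    using weyl_sym_add[OF weyl_sym_V weyl_sym_mult_poly[OF symmetric_poly_mult[OF
          symmetric_poly_Const[of "-1"] symmetric_poly_u]], of p q p q]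
    by (simp add: V_vandermonde Const_uminus)
  then have S: "?S \<subseteq> ?Ann" by blast
  then show "left_ideal weyl_sym hull ?S \<subseteq> ?Ann"
    by (intro hull_minimal left_ideal_annihilator)
  show "?Ann \<subseteq> left_ideal weyl_sym hull ?S"
    unfolding hull_def
  proof (intro subsetI InterI)
    fix D J assume D: "D \<in> ?Ann" and "J \<in> {t. left_ideal weyl_sym t \<and> ?S \<subseteq> t}"
    \<comment> \<open>Intersecting with the annihilator makes the remainder \<open>E\<close> kill
      \<open>vandermonde\<close>, which forces the polynomial part of \<open>D\<close> to
      vanish.\<close>
    with S have "left_ideal weyl_sym (J \<inter> ?Ann)" "?S \<subseteq> J \<inter> ?Ann"
      by (auto intro: left_ideal_Int left_ideal_annihilator)
    then obtain g E where gE: "E \<in> J \<inter> ?Ann" "D = (\<lambda>f. g * f + E f)"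
      using weyl_sym_decomposition D by blast
    then have "g * vandermonde = 0" using D by simp
    then have "g = 0" using vandermonde_nonzero[where 'n = 'n] by simp
    then show "D \<in> J" using gE by simp
  qed
qed

end
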